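(* Let $d\ge 1$, let $\Sigma$ be a fixed $d\times d$ real symmetric positive definite matrix, and let $A_i = \Sigma^{1/2} G_i^{\rm r}$ $(i=1,2,\dots)$, where the $G_i^{\rm r}$ are independent $d\times d$ real Gaussian matrices whose entries are independent standard (mean $0$, variance $1$) real normals. Let $\mu_1\ge\cdots\ge\mu_d$ be the Lyapunov exponents of the product $P_N = A_N A_{N-1}\cdots A_1$. Then $$\mu_1+\cdots+\mu_d = \frac12\Big(\log\det\Sigma + d\log 2+\sum_{j=0}^{d-1}\Psi\big((j+1)/2\big)\Big).$$
   Context: $\Psi(x) = \Gamma'(x)/\Gamma(x)$ is the digamma function. $\Sigma^{1/2}$ is the positive definite square root. Lyapunov exponents: for i.i.d. $d\times d$ random matrices $A_i$ such that the diagonal elements of $A_i^\dagger A_i$ have finite second moments, the limit $V_d := \lim_{N\to\infty}(P_N^\dagger P_N)^{1/(2N)}$, with $P_N = A_N\cdots A_1$, exists almost surely (Oseledec's multiplicative ergodic theorem) and has nonrandom positive eigenvalues, written $e^{\mu_1}\ge \cdots\ge e^{\mu_d}$; the numbers $\mu_1\ge\cdots\ge\mu_d$ are the Lyapunov exponents. *)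

theory Defs
  imports "HOL-Probability.Probability" "HOL-Computational_Algebra.Polynomial"
begin

definition pos_semidef :: "real^'n^'n \<Rightarrow> bool" where
  "pos_semidef A \<longleftrightarrow> transpose A = A \<and> (\<forall>x. 0 \<le> x \<bullet> (A *v x))"

definition pos_def :: "real^'n^'n \<Rightarrow> bool" where
  "pos_def A \<longleftrightarrow> transpose A = A \<and> (\<forall>x. x \<noteq> 0 \<longrightarrow> 0 < x \<bullet> (A *v x))"

definition pos_def_sqrt :: "real^'n^'n \<Rightarrow> real^'n^'n" where
  "pos_def_sqrt A = (THE B. pos_def B \<and> B ** B = A)"

(* The operations * and ^ on real^'n^'n are not the matrix ones, so powers are iterated (**). *)
definition matrix_pow :: "real^'n^'n \<Rightarrow> nat \<Rightarrow> real^'n^'n" where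
  "matrix_pow A k = (((**) A) ^^ k) (mat 1)"

(* A^(1/k), k > 0, for positive semidefinite A; no meaning is attached to k = 0. *)
definition psd_root :: "nat \<Rightarrow> real^'n^'n \<Rightarrow> real^'n^'n" where
  "psd_root k A = (THE B. pos_semidef B \<and> matrix_pow B k = A)"

definition char_poly_matrix :: "real^'n^'n \<Rightarrow> real poly" where
  "char_poly_matrix A = det (mat [:0, 1:] - (\<chi> i j. [:A $ i $ j:]))"

(* The numbers l 1, ..., l d are all the eigenvalues, repeated by multiplicity. *)
definition eigenvalues_are :: "real^'n^'n \<Rightarrow> (nat \<Rightarrow> real) \<Rightarrow> bool" where
  "eigenvalues_are A l \<longleftrightarrow> char_poly_matrix A = (\<Prod>i = 1..CARD('n). [:- l i, 1:])"

(* A N ** ... ** A 1; the entry A 0 is not used. *)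
primrec left_product :: "(nat \<Rightarrow> real^'n^'n) \<Rightarrow> nat \<Rightarrow> real^'n^'n" where
  "left_product A 0 = mat 1"
| "left_product A (Suc N) = A (Suc N) ** left_product A N"

(* The limit matrix may depend on the sample point; its eigenvalues exp (mu i) may not.
   The values of mu outside {1..d} are irrelevant. *)
definition lyapunov_exponents ::
    "'w measure \<Rightarrow> (nat \<Rightarrow> 'w \<Rightarrow> real^'n^'n) \<Rightarrow> (nat \<Rightarrow> real) \<Rightarrow> bool" where
  "lyapunov_exponents M A \<mu> \<longleftrightarrow>
     (\<forall>i\<in>{1..CARD('n)}. \<forall>j\<in>{1..CARD('n)}. i \<le> j \<longrightarrow> \<mu> j \<le> \<mu> i) \<and>
     (AE \<omega> in M. \<exists>V.
        (\<lambda>N. let P = left_product (\<lambda>i. A i \<omega>) N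
              in psd_root (2 * N) (transpose P ** P)) \<longlonglongrightarrow> V \<and>
        eigenvalues_are V (\<lambda>i. exp (\<mu> i)))"

definition std_gaussian_matrix :: "'w measure \<Rightarrow> ('w \<Rightarrow> real^'n^'n) \<Rightarrow> bool" where
  "std_gaussian_matrix M X \<longleftrightarrow>
     prob_space.indep_vars M (\<lambda>_. borel) (\<lambda>(i, j) \<omega>. X \<omega> $ i $ j) UNIV \<and>
     (\<forall>i j. distributed M lborel (\<lambda>\<omega>. X \<omega> $ i $ j) std_normal_density)"

end

theory Submission
  imports Defs
begin

text \<open>
  The sum of the exponents only sees determinants. The determinant of the limit matrix \<open>V\<close> is
  \<open>exp (\<mu> 1 + \<dots> + \<mu> d)\<close>, and by continuity and multiplicativity it is the limit of
  \<open>\<bar>det P\<^sub>N\<bar> powr (1 / N) = sqrt (det \<Sigma>) * (\<Prod>i = 1..N. \<bar>det (G i)\<bar> powr (1 / N))\<close>.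
  That the roots in the definition are the expected matrices, so that taking determinants commutes
  with them (\<open>det_psd_root\<close>, \<open>det_pos_def_sqrt\<close>), rests on the spectral theorem for real
  symmetric matrices.

  It remains to identify an almost sure limit that is already known to exist and to be constant.
  For this the first two moments of the reciprocal products
  \<open>Y N = (\<Prod>i = 1..N. \<bar>det (G i)\<bar> powr (- 1 / N))\<close> suffice: by independence they are
  \<open>h (1 / (2 * N)) ^ N\<close> and \<open>h (1 / N) ^ N\<close>, where \<open>h a\<close> is the expectation of
  \<open>\<bar>det G\<bar> powr (- 2 * a)\<close>. Since \<open>h 0 = 1\<close>, they converge to \<open>exp (h' / 2)\<close> and
  \<open>exp h'\<close>, with \<open>h'\<close> the derivative of \<open>h\<close> at \<open>0\<close>. The second limit is the square of the first,
  so the variance vanishes in the limit, and Fatou's lemma shows that the almost sure limit is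
  \<open>exp (h' / 2)\<close> (\<open>AE_limit_eq_of_moments\<close>).

  The function \<open>h\<close> is explicit (\<open>nn_integral_det_std_gaussian_matrix\<close>):
  \<open>h a = (\<Prod>m = 1..d. 2 powr (- a) * Gamma (m / 2 - a) / Gamma (m / 2))\<close>. Geometrically,
  \<open>\<bar>det G\<bar>\<close> is a product of distances of a row to the span of other rows, and the squared
  distance of a Gaussian vector to a subspace of codimension \<open>m\<close> is chi-squared with \<open>m\<close> degrees of
  freedom. Differentiating \<open>h\<close> at \<open>0\<close> produces \<open>- (ln 2 + Digamma (m / 2))\<close> for each \<open>m\<close>. Negative
  moments are used because the Laplace transform of the squared distance yields them directly,
  by integration against \<open>t powr (a - 1)\<close>.
\<close>

section \<open>Spectral theorem and roots of symmetric matrices\<close>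

lemma symmetric_inner: 
  fixes A :: "real^'n^'n" assumes "transpose A = A"
  shows "x \<bullet> (A *v y) = (A *v x) \<bullet> y"
  by (metis assms dot_lmul_matrix inner_commute transpose_matrix_vector)

text \<open>
  The first-order condition at a maximum: a linear term in \<open>t\<close> that is dominated by a quadratic one for
  both signs of \<open>t\<close> vanishes.
\<close>

lemma linear_coeff_zero:
  fixes b c :: real
  assumes "\<And>t. 2 * t * b \<le> t\<^sup>2 * c"
  shows "b = 0"
proof (rule ccontr)
  assume b: "b \<noteq> 0"
  define s where "s = \<bar>c\<bar> + 1"
  have s: "s > 0" "c < s" by (auto simp: s_def)
  have "2 * (b / s) * b \<le> (b / s)\<^sup>2 * c" by (rule assms)
  also have "\<dots> \<le> (b / s)\<^sup>2 * s" using s by (intro mult_left_mono) auto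
  also have "\<dots> = (b / s) * b" using s by (simp add: power2_eq_square)
  finally have "b * b / s \<le> 0" by simp
  moreover have "b * b / s > 0" using b s by (metis divide_pos_pos mult_neg_neg mult_pos_pos linorder_neqE_linordered_idom)
  ultimately show False by simp
qed

text \<open>
  A maximiser \<open>v\<close> of the quadratic form on the unit sphere of \<open>S\<close> is an eigenvector: by the
  first-order condition the residual \<open>A v - l v\<close>, which lies in \<open>S\<close>, is orthogonal to all of \<open>S\<close>.
\<close>

lemma symmetric_has_eigenvector:
  fixes A :: "real^'n^'n"
  assumes sym: "transpose A = A" and S: "subspace S" and inv: "\<And>x. x \<in> S \<Longrightarrow> A *v x \<in> S"
    and "S \<noteq> {0}"
  obtains v l where "v \<in> S" "norm v = 1" "A *v v = l *\<^sub>R v"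
proof -
  let ?K = "sphere 0 1 \<inter> S"
  have "compact ?K" by (intro compact_Int_closed compact_sphere closed_subspace S)
  moreover have "?K \<noteq> {}"
  proof -
    obtain x where "x \<in> S" "x \<noteq> 0" using \<open>S \<noteq> {0}\<close> subspace_0[OF S] by auto
    then have "(1 / norm x) *\<^sub>R x \<in> ?K" by (auto intro: subspace_scale[OF S])
    then show ?thesis by blast
  qed
  moreover have "continuous_on ?K (\<lambda>x. x \<bullet> (A *v x))"
    by (intro continuous_intros matrix_vector_mult_linear_continuous_on)
  ultimately obtain v where v: "v \<in> ?K" and max: "\<And>x. x \<in> ?K \<Longrightarrow> x \<bullet> (A *v x) \<le> v \<bullet> (A *v v)"
    using continuous_attains_sup[of ?K] by blast
  define l where "l = v \<bullet> (A *v v)"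
  have nv: "norm v = 1" "v \<in> S" using v by auto
  have le: "x \<bullet> (A *v x) \<le> l * (x \<bullet> x)" if "x \<in> S" for x
  proof (cases "x = 0")
    case False
    let ?y = "(1 / norm x) *\<^sub>R x"
    \<comment> \<open>The form is homogeneous of degree two, so the maximum on the sphere bounds it on all of \<open>S\<close>.\<close>
    have "?y \<in> ?K" using that False by (auto intro: subspace_scale[OF S])
    from max[OF this] have "(x \<bullet> (A *v x)) / (norm x)\<^sup>2 \<le> l"
      by (simp add: l_def matrix_vector_mult_scaleR power2_eq_square)
    then show ?thesis using False by (simp add: divide_le_eq dot_square_norm)
  qed simp
  define z where "z = A *v v - l *\<^sub>R v"
  have zS: "z \<in> S" unfolding z_def using nv by (intro subspace_diff subspace_scale S inv)
  have vv: "v \<bullet> v = 1" using nv by (simp add: dot_square_norm)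
  have key: "w \<bullet> z = 0" if "w \<in> S" for w
  proof (rule linear_coeff_zero)
    fix t :: real
    have "(v + t *\<^sub>R w) \<bullet> (A *v (v + t *\<^sub>R w)) \<le> l * ((v + t *\<^sub>R w) \<bullet> (v + t *\<^sub>R w))"
      by (intro le subspace_add subspace_scale S that nv)
    moreover have "v \<bullet> (A *v w) = w \<bullet> (A *v v)" 
      using symmetric_inner[OF sym, of v w] by (simp add: inner_commute)
    ultimately show "2 * t * (w \<bullet> z) \<le> t\<^sup>2 * (l * (w \<bullet> w) - w \<bullet> (A *v w))"
      using vv by (simp add: z_def matrix_vector_right_distrib matrix_vector_mult_scaleR algebra_simps
         inner_commute[of v w] l_def[symmetric] power2_eq_square)
  qed
  from key[OF zS] have "z = 0" by simp
  then show thesis using nv that[of v l] by (simp add: z_def)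
qed

text \<open>
  Induction on the dimension: split off one eigenvector; its orthogonal complement in \<open>S\<close> is again
  invariant because \<open>A\<close> is symmetric.
\<close>

lemma symmetric_eigenbasis_subspace:
  fixes A :: "real^'n^'n"
  assumes sym: "transpose A = A" and S: "subspace S" and inv: "\<And>x. x \<in> S \<Longrightarrow> A *v x \<in> S"
  shows "\<exists>B. B \<subseteq> S \<and> pairwise orthogonal B \<and> (\<forall>b\<in>B. norm b = 1 \<and> (\<exists>l. A *v b = l *\<^sub>R b)) \<and> S \<subseteq> span B"
  using S inv
proof (induction "dim S" arbitrary: S)
  case 0
  then have "S \<subseteq> {0}" using dim_eq_0 by metis
  then show ?case by (intro exI[of _ "{}"]) auto
next
  case (Suc n)
  have "S \<noteq> {0}" using Suc.hyps(2) by auto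
  then obtain v l where v: "v \<in> S" "norm v = 1" "A *v v = l *\<^sub>R v"
    using symmetric_has_eigenvector[OF sym Suc.prems] by blast
  have vv: "v \<bullet> v = 1" using v by (simp add: dot_square_norm)
  define T where "T = S \<inter> {x. v \<bullet> x = 0}"
  have T: "subspace T" unfolding T_def by (intro subspace_inter Suc.prems subspace_hyperplane)
  have invT: "A *v x \<in> T" if "x \<in> T" for x
    using that Suc.prems(2) symmetric_inner[OF sym, of v x] v by (auto simp: T_def)
  have "v \<notin> T" using vv by (auto simp: T_def)
  have decomp: "\<exists>y\<in>T. x = y + (v \<bullet> x) *\<^sub>R v" if "x \<in> S" for x
    using that v vv by (intro bexI[of _ "x - (v \<bullet> x) *\<^sub>R v"])
     (auto simp: T_def inner_diff_right intro!: subspace_diff subspace_scale Suc.prems)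
  have spanT: "span T = T" using T by (rule span_eq_iff[THEN iffD2])
  have "span (insert v T) = S"
  proof
    show "span (insert v T) \<subseteq> S" using v Suc.prems by (intro span_minimal) (auto simp: T_def)
    show "S \<subseteq> span (insert v T)"
    proof
      fix x assume "x \<in> S"
      then obtain y where "y \<in> T" "x = y + (v \<bullet> x) *\<^sub>R v" using decomp by blast
      then show "x \<in> span (insert v T)"
        by (metis insertCI span_add span_base span_scale)
    qed
  qed
  then have "dim S = dim (insert v T)" by (metis dim_span)
  also have "\<dots> = Suc (dim T)" using \<open>v \<notin> T\<close> by (simp only: dim_insert spanT if_False)
  finally have "n = dim T" using Suc.hyps(2) by simp
  from Suc.hyps(1)[OF this T invT] obtain B where B: "B \<subseteq> T" "pairwise orthogonal B"
     "\<forall>b\<in>B. norm b = 1 \<and> (\<exists>l. A *v b = l *\<^sub>R b)" "T \<subseteq> span B" by blast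
  show ?case
  proof (intro exI[of _ "insert v B"] conjI)
    show "insert v B \<subseteq> S" using B v by (auto simp: T_def)
    show "pairwise orthogonal (insert v B)"
      using B by (auto simp: pairwise_insert orthogonal_def T_def inner_commute)
    show "\<forall>b\<in>insert v B. norm b = 1 \<and> (\<exists>l. A *v b = l *\<^sub>R b)" using B v by auto
    show "S \<subseteq> span (insert v B)"
    proof
      fix x assume "x \<in> S"
      then obtain y where "y \<in> T" "x = y + (v \<bullet> x) *\<^sub>R v" using decomp by blast
      moreover from this have "y \<in> span (insert v B)" using B(4) span_mono[of B "insert v B"] by auto
      ultimately show "x \<in> span (insert v B)"
        by (metis insertCI span_add span_base span_scale)
    qed
  qed
qed

definition diag_matrix :: "('n \<Rightarrow> real) \<Rightarrow> real^'n^'n" where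
  "diag_matrix d = (\<chi> i j. if i = j then d i else 0)"

definition orth_conj :: "real^'n^'n \<Rightarrow> ('n \<Rightarrow> real) \<Rightarrow> real^'n^'n" where
  "orth_conj Q d = transpose Q ** diag_matrix d ** Q"

lemma diag_matrix_left_nth: "(diag_matrix d ** W) $ i $ j = d i * W $ i $ j"
  by (simp add: diag_matrix_def matrix_matrix_mult_def if_distrib if_distribR cong: if_cong)

lemma diag_matrix_right_nth: "(W ** diag_matrix d) $ i $ j = W $ i $ j * d j"
  by (simp add: diag_matrix_def matrix_matrix_mult_def if_distrib if_distribR cong: if_cong)

lemma diag_matrix_mult: "diag_matrix d ** diag_matrix e = diag_matrix (\<lambda>i. d i * e i)"
  by (simp add: vec_eq_iff diag_matrix_left_nth) (simp add: diag_matrix_def)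

lemma transpose_diag_matrix [simp]: "transpose (diag_matrix d) = diag_matrix d"
  by (auto simp: diag_matrix_def transpose_def vec_eq_iff)

lemma transpose_orth_conj [simp]: "transpose (orth_conj Q d) = orth_conj Q d"
  by (simp add: orth_conj_def matrix_transpose_mul matrix_mul_assoc)

lemma orth_conj_mult:
  assumes "orthogonal_matrix Q"
  shows "orth_conj Q d ** orth_conj Q e = orth_conj Q (\<lambda>i. d i * e i)"
proof -
  have "orth_conj Q d ** orth_conj Q e
      = transpose Q ** diag_matrix d ** (Q ** transpose Q) ** diag_matrix e ** Q"
    by (simp add: orth_conj_def matrix_mul_assoc)
  also have "\<dots> = transpose Q ** (diag_matrix d ** diag_matrix e) ** Q"
    using assms by (simp add: orthogonal_matrix_def matrix_mul_assoc)
  finally show ?thesis by (simp add: orth_conj_def diag_matrix_mult)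
qed

lemma matrix_pow_orth_conj:
  fixes Q :: "real^'n^'n"
  assumes Q: "orthogonal_matrix Q"
  shows "matrix_pow (orth_conj Q d) k = orth_conj Q (\<lambda>i. d i ^ k)"
proof (induction k)
  case 0
  have "diag_matrix (\<lambda>i. 1) = (mat 1 :: real^'n^'n)" by (simp add: diag_matrix_def mat_def)
  moreover have "matrix_pow (orth_conj Q d) 0 = mat 1" by (simp add: matrix_pow_def)
  ultimately show ?case using Q by (simp add: orth_conj_def orthogonal_matrix_def)
next
  case (Suc k)
  have "matrix_pow (orth_conj Q d) (Suc k) = orth_conj Q d ** matrix_pow (orth_conj Q d) k"
    by (simp add: matrix_pow_def)
  then show ?case by (simp add: Suc orth_conj_mult[OF Q])
qed

lemma det_orth_conj:
  assumes Q: "orthogonal_matrix Q"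
  shows "det (orth_conj Q d) = (\<Prod>i\<in>UNIV. d i)"
proof -
  have "det Q * det Q = 1" using det_orthogonal_matrix[OF Q] by auto
  moreover have "det (diag_matrix d) = (\<Prod>i\<in>UNIV. d i)"
    by (subst det_diagonal) (auto simp: diag_matrix_def)
  ultimately show ?thesis by (simp add: orth_conj_def det_mul)
qed

lemma orth_conj_quadratic: "x \<bullet> (orth_conj Q d *v x) = (\<Sum>i\<in>UNIV. d i * ((Q *v x) $ i)\<^sup>2)"
proof -
  have "x \<bullet> (orth_conj Q d *v x) = (Q *v x) \<bullet> (diag_matrix d *v (Q *v x))"
    by (simp add: orth_conj_def matrix_vector_mul_assoc[symmetric] inner_commute[of x] dot_lmul_matrix
        inner_commute[of "Q *v x"])
  also have "diag_matrix d *v (Q *v x) = (\<chi> i. d i * (Q *v x) $ i)"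
    by (simp add: vec_eq_iff matrix_vector_mult_def[of "diag_matrix d"])
       (simp add: diag_matrix_def if_distrib if_distribR cong: if_cong)
  finally show ?thesis by (simp add: inner_vec_def power2_eq_square mult_ac)
qed

lemma spectral_theorem:
  fixes A :: "real^'n^'n"
  assumes sym: "transpose A = A"
  obtains Q d where "orthogonal_matrix Q" "A = orth_conj Q d"
proof -
  obtain B where B: "pairwise orthogonal B" "\<And>b. b \<in> B \<Longrightarrow> norm b = 1"
     "\<And>b. b \<in> B \<Longrightarrow> \<exists>l. A *v b = l *\<^sub>R b" "span B = UNIV"
    using symmetric_eigenbasis_subspace[OF sym subspace_UNIV] by auto
  have ind: "independent B"
    using B(1,2) by (intro pairwise_orthogonal_independent) force+
  have "finite B" using ind by (rule independent_imp_finite)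
  moreover have "card B = CARD('n)"
    using dim_eq_card[of B UNIV] ind B(4) by simp
  ultimately obtain f :: "'n \<Rightarrow> real^'n" where f: "bij_betw f UNIV B"
    using finite_same_card_bij[of "UNIV :: 'n set" B] by auto
  have fB: "f i \<in> B" for i using f by (auto simp: bij_betw_def)
  have orth: "f i \<bullet> f j = (if i = j then 1 else 0)" for i j
  proof (cases "i = j")
    case True then show ?thesis using B(2)[OF fB] by (simp add: dot_square_norm)
  next
    case False
    then have "f i \<noteq> f j" using f by (auto simp: bij_betw_def inj_on_def)
    then show ?thesis using False B(1) fB by (auto simp: pairwise_def orthogonal_def)
  qed
  define Q :: "real^'n^'n" where "Q = (\<chi> i. f i)"
  define d where "d i = (SOME l. A *v f i = l *\<^sub>R f i)" for i
  have d: "A *v f i = d i *\<^sub>R f i" for i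
    unfolding d_def by (rule someI_ex) (rule B(3)[OF fB])
  have "Q ** transpose Q = mat 1"
    using orth by (simp add: vec_eq_iff Q_def matrix_matrix_mult_def transpose_def mat_def inner_vec_def)
  then have Q: "orthogonal_matrix Q"
    using matrix_left_right_inverse by (auto simp: orthogonal_matrix_def)
  have "A ** transpose Q = transpose Q ** diag_matrix d"
  proof -
    have "(A ** transpose Q) $ i $ j = (A *v f j) $ i" for i j
      by (simp add: matrix_matrix_mult_def transpose_def Q_def matrix_vector_mult_def)
    then show ?thesis
      by (simp add: vec_eq_iff diag_matrix_right_nth d) (simp add: transpose_def Q_def)
  qed
  then have "A ** (transpose Q ** Q) = orth_conj Q d"
    by (simp add: orth_conj_def matrix_mul_assoc)
  then show thesis using that[OF Q] Q by (simp add: orthogonal_matrix_def)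
qed

lemma orth_conj_axis: 
  fixes Q :: "real^'n^'n"
  assumes "orthogonal_matrix Q"
  shows "(transpose Q *v axis i 1) \<bullet> (orth_conj Q d *v (transpose Q *v axis i 1)) = d i"
    and "transpose Q *v axis i 1 \<noteq> 0"
proof -
  have *: "Q *v (transpose Q *v axis i 1) = axis i 1"
    using assms by (simp add: matrix_vector_mul_assoc orthogonal_matrix_def del: transpose_matrix_vector)
  then show "(transpose Q *v axis i 1) \<bullet> (orth_conj Q d *v (transpose Q *v axis i 1)) = d i"
    unfolding orth_conj_quadratic * 
    by (simp add: axis_def if_distrib if_distribR cong: if_cong)
  show "transpose Q *v axis i 1 \<noteq> 0"
  proof
    assume "transpose Q *v axis i 1 = 0"
    with * have "axis i (1::real) = 0" by simp
    then show False by (simp add: axis_eq_0_iff)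
  qed
qed

lemma pos_semidef_orth_conj_iff:
  fixes Q :: "real^'n^'n"
  assumes "orthogonal_matrix Q"
  shows "pos_semidef (orth_conj Q d) \<longleftrightarrow> (\<forall>i. 0 \<le> d i)"
proof
  show "\<forall>i. 0 \<le> d i" if "pos_semidef (orth_conj Q d)"
    using that orth_conj_axis(1)[OF assms] unfolding pos_semidef_def by metis
  show "pos_semidef (orth_conj Q d)" if "\<forall>i. 0 \<le> d i"
    using that by (auto simp: pos_semidef_def orth_conj_quadratic intro!: sum_nonneg)
qed

lemma pos_def_orth_conj_iff:
  fixes Q :: "real^'n^'n"
  assumes Q: "orthogonal_matrix Q"
  shows "pos_def (orth_conj Q d) \<longleftrightarrow> (\<forall>i. 0 < d i)"
proof
  show "\<forall>i. 0 < d i" if "pos_def (orth_conj Q d)"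
    using that orth_conj_axis[OF assms] unfolding pos_def_def by metis
  assume d: "\<forall>i. 0 < d i"
  show "pos_def (orth_conj Q d)" unfolding pos_def_def
  proof (intro conjI allI impI)
    fix x :: "real^'n" assume "x \<noteq> 0"
    have "Q *v x \<noteq> 0"
    proof
      assume "Q *v x = 0"
      then have "transpose Q *v (Q *v x) = 0" by simp
      then show False using Q \<open>x \<noteq> 0\<close> by (simp add: matrix_vector_mul_assoc orthogonal_matrix_def del: transpose_matrix_vector)
    qed
    then obtain i where "(Q *v x) $ i \<noteq> 0" by (auto simp: vec_eq_iff)
    then show "0 < x \<bullet> (orth_conj Q d *v x)" unfolding orth_conj_quadratic
      using d by (intro sum_pos2[of _ i]) (auto simp: less_imp_le)
  qed simp
qed

text \<open>
  Diagonalise both roots as \<open>B = Q\<^sup>T D Q\<close> and \<open>C = R\<^sup>T E R\<close> and let \<open>W = Q R\<^sup>T\<close>. Then \<open>B = C\<close> says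
  \<open>D W = W E\<close>, and equality of the powers says the same for the powers of the diagonals. Entrywise,
  either \<open>W\<close> vanishes or two nonnegative numbers have equal \<open>k\<close>-th powers.
\<close>

lemma pos_semidef_root_unique:
  fixes B C :: "real^'n^'n"
  assumes "pos_semidef B" "pos_semidef C" "matrix_pow B k = matrix_pow C k" "k > 0"
  shows "B = C"
proof -
  obtain Q d where Q: "orthogonal_matrix Q" and B: "B = orth_conj Q d"
    using spectral_theorem assms(1) unfolding pos_semidef_def by metis
  obtain R e where R: "orthogonal_matrix R" and C: "C = orth_conj R e"
    using spectral_theorem assms(2) unfolding pos_semidef_def by metis
  have d: "d i \<ge> 0" and e: "e i \<ge> 0" for i
    using assms(1,2) unfolding B C pos_semidef_orth_conj_iff[OF Q] pos_semidef_orth_conj_iff[OF R] by auto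
  have QQ: "Q ** transpose Q = mat 1" "transpose Q ** Q = mat 1" 
   and RR: "R ** transpose R = mat 1" "transpose R ** R = mat 1"
    using Q R by (auto simp: orthogonal_matrix_def)
  define W where "W = Q ** transpose R"
  have conj: "orth_conj Q f = orth_conj R g \<longleftrightarrow> diag_matrix f ** W = W ** diag_matrix g" for f g
  proof
    assume "orth_conj Q f = orth_conj R g"
    then have "Q ** orth_conj Q f ** transpose R = Q ** orth_conj R g ** transpose R" by simp
    then have "(Q ** transpose Q) ** diag_matrix f ** W = W ** diag_matrix g ** (R ** transpose R)"
      by (simp add: orth_conj_def W_def matrix_mul_assoc)
    then show "diag_matrix f ** W = W ** diag_matrix g" by (simp add: QQ RR)
  next
    assume "diag_matrix f ** W = W ** diag_matrix g"
    then have "transpose Q ** (diag_matrix f ** W) ** R = transpose Q ** (W ** diag_matrix g) ** R"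
      by simp
    then have "transpose Q ** diag_matrix f ** Q ** (transpose R ** R)
        = (transpose Q ** Q) ** transpose R ** diag_matrix g ** R"
      by (simp add: W_def matrix_mul_assoc)
    then show "orth_conj Q f = orth_conj R g" by (simp add: orth_conj_def QQ RR)
  qed
  have "d i ^ k * W $ i $ j = W $ i $ j * e j ^ k" for i j
    using assms(3) unfolding B C matrix_pow_orth_conj[OF Q] matrix_pow_orth_conj[OF R] conj
    by (simp add: vec_eq_iff diag_matrix_left_nth diag_matrix_right_nth)
  then have "W $ i $ j = 0 \<or> d i ^ k = e j ^ k" for i j by (metis mult.commute mult_cancel_left)
  then have "W $ i $ j = 0 \<or> d i = e j" for i j
    using d e \<open>k > 0\<close> by (metis power_eq_imp_eq_base)
  then have "d i * W $ i $ j = W $ i $ j * e j" for i j by (metis mult.commute mult_zero_right)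
  then show ?thesis unfolding B C conj by (simp add: vec_eq_iff diag_matrix_left_nth diag_matrix_right_nth)
qed

lemma det_psd_root:
  fixes A :: "real^'n^'n"
  assumes A: "pos_semidef A" and k: "k > 0"
  shows "det (psd_root k A) = root k (det A)"
proof -
  obtain Q d where Q: "orthogonal_matrix Q" and Ad: "A = orth_conj Q d"
    using spectral_theorem A unfolding pos_semidef_def by metis
  have d: "d i \<ge> 0" for i using A unfolding Ad pos_semidef_orth_conj_iff[OF Q] by auto
  define B where "B = orth_conj Q (\<lambda>i. root k (d i))"
  have "pos_semidef B" unfolding B_def pos_semidef_orth_conj_iff[OF Q] using d k by simp
  moreover have "matrix_pow B k = A"
    unfolding B_def matrix_pow_orth_conj[OF Q] Ad using d k by simp
  ultimately have "psd_root k A = B"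
    unfolding psd_root_def using k by (intro the_equality) (auto intro: pos_semidef_root_unique)
  moreover have "(\<Prod>i\<in>I. root k (d i)) = root k (\<Prod>i\<in>I. d i)" for I
    using k by (induction I rule: infinite_finite_induct) (auto simp: real_root_mult)
  ultimately show ?thesis
    by (simp add: B_def Ad det_orth_conj[OF Q])
qed

lemma pos_semidef_gram: "pos_semidef (transpose P ** P)"
proof -
  have "x \<bullet> ((transpose P ** P) *v x) = (P *v x) \<bullet> (P *v x)" for x
    by (simp add: matrix_vector_mul_assoc[symmetric] inner_commute[of x] dot_lmul_matrix)
  then show ?thesis by (simp add: pos_semidef_def matrix_transpose_mul)
qed

lemma det_psd_root_gram:
  fixes P :: "real^'n^'n"
  assumes "N > 0"
  shows "det (psd_root (2 * N) (transpose P ** P)) = \<bar>det P\<bar> powr (1 / N)"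
proof -
  have "det (psd_root (2 * N) (transpose P ** P)) = root N (root 2 ((det P)\<^sup>2))"
    using assms by (subst det_psd_root[OF pos_semidef_gram]) (simp_all add: det_mul power2_eq_square real_root_mult_exp mult.commute)
  also have "root 2 ((det P)\<^sup>2) = \<bar>det P\<bar>" by (simp add: sqrt_def[symmetric])
  finally show ?thesis using assms
    by (cases "det P = 0") (simp_all add: root_powr_inverse inverse_eq_divide)
qed

lemma pos_def_imp_pos_semidef:
  assumes "pos_def A"
  shows "pos_semidef A"
  unfolding pos_semidef_def
proof (intro conjI allI)
  show "0 \<le> x \<bullet> (A *v x)" for x
    using assms by (cases "x = 0") (auto simp: pos_def_def less_imp_le)
qed (use assms in \<open>auto simp: pos_def_def\<close>)

lemma det_pos_def:
  assumes "pos_def A"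
  shows "det A > 0"
proof -
  obtain Q d where Q: "orthogonal_matrix Q" and A: "A = orth_conj Q d"
    using spectral_theorem assms unfolding pos_def_def by metis
  show ?thesis
    using assms unfolding A pos_def_orth_conj_iff[OF Q] det_orth_conj[OF Q] by (simp add: prod_pos)
qed

lemma det_pos_def_sqrt:
  fixes A :: "real^'n^'n"
  assumes A: "pos_def A"
  shows "det (pos_def_sqrt A) = sqrt (det A)"
proof -
  obtain Q d where Q: "orthogonal_matrix Q" and Ad: "A = orth_conj Q d"
    using spectral_theorem A unfolding pos_def_def by metis
  have d: "d i > 0" for i using A unfolding Ad pos_def_orth_conj_iff[OF Q] by auto
  define B where "B = orth_conj Q (\<lambda>i. sqrt (d i))"
  have B: "pos_def B" unfolding B_def pos_def_orth_conj_iff[OF Q] using d by simp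
  have B2: "B ** B = A"
    unfolding B_def orth_conj_mult[OF Q] Ad using d by (simp add: less_imp_le)
  have [simp]: "matrix_pow C 2 = C ** C" for C :: "real^'n^'n"
    by (simp add: matrix_pow_def numeral_2_eq_2)
  have "C = B" if "pos_def C \<and> C ** C = A" for C
  proof (rule pos_semidef_root_unique[where k = 2])
    show "pos_semidef C" "pos_semidef B" using that B by (auto dest: pos_def_imp_pos_semidef)
    show "matrix_pow C 2 = matrix_pow B 2" using that B2 by simp
  qed simp
  with B B2 have "pos_def_sqrt A = B"
    unfolding pos_def_sqrt_def by (intro the_equality) blast+
  moreover have "det B ^ 2 = det A" unfolding B2[symmetric] by (simp add: det_mul power2_eq_square)
  moreover have "det B > 0" by (rule det_pos_def[OF B])
  ultimately show ?thesis using real_sqrt_unique[of "det B" "det A"] by simp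
qed

lemma poly_det:
  fixes A :: "real poly^'n^'n"
  shows "poly (det A) x = det (\<chi> i j. poly (A $ i $ j) x)"
  by (simp add: det_def poly_sum poly_prod of_int_poly)

lemma det_eq_prod_eigenvalues:
  fixes V :: "real^'n^'n"
  assumes "eigenvalues_are V l"
  shows "det V = (\<Prod>i = 1..CARD('n). l i)"
proof -
  have "poly (char_poly_matrix V) 0 = det (- V)"
    unfolding char_poly_matrix_def poly_det
    by (rule arg_cong[of _ _ det]) (auto simp: vec_eq_iff mat_def)
  also have "- V = matrix_matrix_mult (mat (-1)) V"
    by (simp add: vec_eq_iff matrix_matrix_mult_def mat_def if_distrib if_distribR sum.delta cong: if_cong)
  also have "det \<dots> = (-1) ^ CARD('n) * det V"
    unfolding det_mul by (subst det_diagonal) (auto simp: mat_def)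
  finally have 1: "poly (char_poly_matrix V) 0 = (-1) ^ CARD('n) * det V" .
  have "poly (char_poly_matrix V) 0 = (\<Prod>i = 1..CARD('n). - l i)"
    using assms by (simp add: eigenvalues_are_def poly_prod)
  also have "\<dots> = (-1) ^ CARD('n) * (\<Prod>i = 1..CARD('n). l i)" by (simp add: prod_uminus)
  finally show ?thesis using 1 by simp
qed

lemma tendsto_det:
  fixes A :: "'a \<Rightarrow> real^'n^'n"
  assumes "(A \<longlongrightarrow> V) F"
  shows "((\<lambda>x. det (A x)) \<longlongrightarrow> det V) F"
  unfolding det_def by (intro tendsto_intros assms)

lemma det_left_product: "det (left_product A N) = (\<Prod>i = 1..N. det (A i))"
  by (induction N) (auto simp: det_mul)

section \<open>Gaussian vectors\<close>

lemma borel_measurable_vec_iff: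
  fixes f :: "'a \<Rightarrow> real^'n"
  shows "f \<in> borel_measurable M \<longleftrightarrow> (\<forall>i. (\<lambda>x. f x $ i) \<in> borel_measurable M)"
proof -
  have "f \<in> borel_measurable M \<longleftrightarrow> (\<forall>b\<in>Basis. (\<lambda>x. f x \<bullet> b) \<in> borel_measurable M)"
    by (rule borel_measurable_euclidean_space)
  also have "\<dots> \<longleftrightarrow> (\<forall>i. (\<lambda>x. f x $ i) \<in> borel_measurable M)"
    by (auto simp: Basis_vec_def inner_axis)
  finally show ?thesis .
qed

lemma borel_measurable_vec_nth[measurable (raw)]:
  fixes f :: "'a \<Rightarrow> real^'n"
  shows "f \<in> borel_measurable M \<Longrightarrow> (\<lambda>x. f x $ i) \<in> borel_measurable M"
  by (simp add: borel_measurable_vec_iff)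

lemma borel_measurable_matrix_nth[measurable (raw)]:
  fixes f :: "'a \<Rightarrow> real^'n^'m"
  assumes "f \<in> borel_measurable M"
  shows "(\<lambda>x. f x $ i) \<in> borel_measurable M"
  by (rule borel_measurable_continuous_on[OF _ assms]) (intro continuous_intros)

lemma borel_measurable_det:
  fixes f :: "'a \<Rightarrow> real^'n^'n"
  assumes "\<And>i j. (\<lambda>x. f x $ i $ j) \<in> borel_measurable M"
  shows "(\<lambda>x. det (f x)) \<in> borel_measurable M"
  unfolding det_def using assms by measurable

interpretation std_normal: prob_space std_normal_distribution
  by (rule prob_space_normal_density) simp

interpretation std_normal_product: product_prob_space "\<lambda>i. std_normal_distribution" I for I :: "'i set"
  by standard

text \<open>
  The law of a row of the random matrix, as a product of its coordinates. Its rotation invariance is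
  visible in the characteristic function \<open>integral_iexp_gaussian_vec\<close>, which depends on the norm of
  the frequency alone.
\<close>

definition gaussian_vec :: "(real^'n) measure" where
  "gaussian_vec = distr (\<Pi>\<^sub>M i\<in>UNIV. std_normal_distribution) borel (\<lambda>f. \<chi> i. f i)"

lemma vec_lambda_measurable[measurable]:
  "(\<lambda>f. \<chi> i. (f i :: real)) \<in> borel_measurable (\<Pi>\<^sub>M i\<in>UNIV. std_normal_distribution)"
  by (simp add: borel_measurable_vec_iff)

lemma prob_space_gaussian_vec: "prob_space gaussian_vec"
  unfolding gaussian_vec_def by (intro prob_space.prob_space_distr vec_lambda_measurable) (rule std_normal_product.prob_space_axioms)

interpretation gaussian_vec: prob_space gaussian_vec by (rule prob_space_gaussian_vec)

interpretation gaussian_rows: product_prob_space "\<lambda>i. gaussian_vec" I for I :: "'i set"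
  by standard

lemma sets_gaussian_vec[simp, measurable_cong]: "sets gaussian_vec = sets borel"
  by (simp add: gaussian_vec_def)

lemma integral_iexp_std_normal:
  "(\<integral>x. iexp (c * x) \<partial>std_normal_distribution) = of_real (exp (- c\<^sup>2 / 2))"
  using char_std_normal_distribution unfolding char_def fun_eq_iff by simp

lemma integrable_iexp:
  assumes "finite_measure M" "f \<in> borel_measurable M"
  shows "integrable M (\<lambda>x. iexp (f x))"
  using assms by (intro finite_measure.integrable_const_bound[where B = 1]) (auto intro!: borel_measurable_continuous_on)

lemma integral_iexp_sum_std_normal:
  assumes "finite I"
  shows "(\<integral>x. iexp (\<Sum>i\<in>I. c i * x i) \<partial>(\<Pi>\<^sub>M i\<in>I. std_normal_distribution)) =
    of_real (exp (- (\<Sum>i\<in>I. (c i)\<^sup>2) / 2))"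
proof -
  have "(\<integral>x. iexp (\<Sum>i\<in>I. c i * x i) \<partial>(\<Pi>\<^sub>M i\<in>I. std_normal_distribution))
      = (\<integral>x. (\<Prod>i\<in>I. iexp (c i * x i)) \<partial>(\<Pi>\<^sub>M i\<in>I. std_normal_distribution))"
    using assms by (simp add: sum_distrib_left exp_sum)
  also have "\<dots> = (\<Prod>i\<in>I. \<integral>x. iexp (c i * x) \<partial>std_normal_distribution)"
    by (intro std_normal_product.product_integral_prod assms integrable_iexp) 
       (auto intro: std_normal.finite_measure_axioms)
  also have "\<dots> = of_real (exp (- (\<Sum>i\<in>I. (c i)\<^sup>2) / 2))"
    using assms unfolding integral_iexp_std_normal 
    by (simp add: sum_negf sum_divide_distrib flip: of_real_prod exp_sum)
  finally show ?thesis .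
qed

lemma integral_iexp_gaussian_vec:
  "(\<integral>y. iexp (v \<bullet> y) \<partial>gaussian_vec) = of_real (exp (- (norm v)\<^sup>2 / 2))"
proof -
  have "(\<integral>y. iexp (v \<bullet> y) \<partial>gaussian_vec)
     = (\<integral>x. iexp (\<Sum>i\<in>UNIV. v $ i * x i) \<partial>(\<Pi>\<^sub>M i\<in>UNIV. std_normal_distribution))"
    unfolding gaussian_vec_def by (subst integral_distr) (simp_all add: inner_vec_def)
  also have "\<dots> = of_real (exp (- (norm v)\<^sup>2 / 2))"
    unfolding integral_iexp_sum_std_normal[OF finite_class.finite_UNIV]
    unfolding power2_norm_eq_inner inner_vec_def by (simp add: power2_eq_square)
  finally show ?thesis .
qed

text \<open>
  The integrand times the density is a multiple of the normal density of variance
  \<open>1 / (1 + 2 * t)\<close>.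
\<close>

lemma integral_exp_square_std_normal:
  assumes "t \<ge> 0"
  shows "(\<integral>x. exp (- t * x\<^sup>2) \<partial>std_normal_distribution) = (1 + 2 * t) powr (- 1 / 2)"
proof -
  define s where "s = 1 / sqrt (1 + 2 * t)"
  have s: "s > 0" "s\<^sup>2 = 1 / (1 + 2 * t)" using assms by (auto simp: s_def power_divide)
  have "std_normal_density x * exp (- t * x\<^sup>2) = s * normal_density 0 s x" for x
  proof -
    have "sqrt (2 * pi * s\<^sup>2) = sqrt (2 * pi) * s"
      using s(1) by (simp add: real_sqrt_mult)
    moreover have "exp (- x\<^sup>2 / 2) * exp (- t * x\<^sup>2) = exp (- x\<^sup>2 / (2 * s\<^sup>2))"
      using assms unfolding exp_add[symmetric] s(2) by (simp add: field_simps)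
    ultimately show ?thesis using s(1) by (simp add: normal_density_def)
  qed
  then have "(\<integral>x. exp (- t * x\<^sup>2) \<partial>std_normal_distribution) = (\<integral>x. s * normal_density 0 s x \<partial>lborel)"
    by (subst integral_density) auto
  also have "\<dots> = s" using s by simp
  also have "s = (1 + 2 * t) powr (- 1 / 2)"
    using assms by (simp add: s_def powr_minus_divide powr_half_sqrt)
  finally show ?thesis .
qed

lemma integral_exp_sum_squares_std_normal:
  assumes "t \<ge> 0" "finite I"
  shows "(\<integral>x. exp (- t * (\<Sum>i\<in>I. (x i)\<^sup>2)) \<partial>(\<Pi>\<^sub>M i\<in>I. std_normal_distribution)) =
    (1 + 2 * t) powr (- card I / 2)"
proof -
  have "(\<integral>x. exp (- t * (\<Sum>i\<in>I. (x i)\<^sup>2)) \<partial>(\<Pi>\<^sub>M i\<in>I. std_normal_distribution))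
     = (\<integral>x. (\<Prod>i\<in>I. exp (- t * (x i)\<^sup>2)) \<partial>(\<Pi>\<^sub>M i\<in>I. std_normal_distribution))"
    using assms by (simp add: sum_distrib_left exp_sum flip: sum_negf)
  also have "\<dots> = (\<Prod>i\<in>I. \<integral>x. exp (- t * x\<^sup>2) \<partial>std_normal_distribution)"
    using assms by (intro std_normal_product.product_integral_prod)
      (auto intro!: std_normal.integrable_const_bound[where B = 1])
  also have "\<dots> = (1 + 2 * t) powr (- card I / 2)"
    using assms unfolding integral_exp_square_std_normal[OF assms(1)]
    by (simp add: powr_realpow[symmetric] powr_powr)
  finally show ?thesis .
qed

text \<open>
  Write \<open>exp (- t * w\<^sup>2)\<close> as the characteristic function of an auxiliary Gaussian variable at
  \<open>sqrt (2 * t) * w\<close>, one variable \<open>x i\<close> for each \<open>i \<in> J\<close>. After exchanging the integrals, the vector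
  \<open>y\<close> is integrated against a character whose frequency is \<open>sqrt (2 * t)\<close> times the combination of the
  orthonormal \<open>q i\<close> with coefficients \<open>x i\<close>, so only the norm of \<open>x\<close> remains and the coordinates decouple.
\<close>

lemma laplace_projection_gaussian_vec:
  fixes q :: "'n \<Rightarrow> real^'n"
  assumes t: "t \<ge> 0"
    and q: "\<And>i j. i \<in> J \<Longrightarrow> j \<in> J \<Longrightarrow> q i \<bullet> q j = (if i = j then 1 else 0)"
  shows "(\<integral>y. exp (- t * (\<Sum>i\<in>J. (q i \<bullet> y)\<^sup>2)) \<partial>gaussian_vec) = (1 + 2 * t) powr (- card J / 2)"
proof -
  let ?N = "\<Pi>\<^sub>M i\<in>J. std_normal_distribution"
  define s where "s = sqrt (2 * t)"
  have s: "s\<^sup>2 = 2 * t" using t by (simp add: s_def)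
  have J: "finite J" by simp
  interpret P: pair_sigma_finite gaussian_vec ?N
    by (intro pair_sigma_finite.intro) (auto intro: prob_space_imp_sigma_finite gaussian_vec.prob_space_axioms std_normal_product.prob_space_axioms)
  interpret PP: pair_prob_space gaussian_vec ?N
    by (intro pair_prob_space.intro P.pair_sigma_finite_axioms) (auto intro: gaussian_vec.prob_space_axioms std_normal_product.prob_space_axioms)
  have sq: "(norm (\<Sum>i\<in>J. x i *\<^sub>R q i))\<^sup>2 = (\<Sum>i\<in>J. (x i)\<^sup>2)" for x
  proof -
    have "(norm (\<Sum>i\<in>J. x i *\<^sub>R q i))\<^sup>2 = (\<Sum>i\<in>J. \<Sum>j\<in>J. x i * x j * (q i \<bullet> q j))"
      by (simp add: dot_square_norm[symmetric] inner_sum_left inner_sum_right mult_ac sum_distrib_left inner_commute)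
    also have "\<dots> = (\<Sum>i\<in>J. \<Sum>j\<in>J. if i = j then x i * x j else 0)"
      by (intro sum.cong) (auto simp: q)
    finally show ?thesis by (simp add: power2_eq_square)
  qed
  have "(\<integral>y. of_real (exp (- t * (\<Sum>i\<in>J. (q i \<bullet> y)\<^sup>2))) \<partial>gaussian_vec)
      = (\<integral>y. (\<integral>x. iexp (\<Sum>i\<in>J. (s * (q i \<bullet> y)) * x i) \<partial>?N) \<partial>gaussian_vec)"
    unfolding integral_iexp_sum_std_normal[OF J]
    by (simp add: power_mult_distrib s sum_distrib_left sum_divide_distrib sum_negf)
  also have "\<dots> = (\<integral>x. (\<integral>y. iexp (\<Sum>i\<in>J. (s * (q i \<bullet> y)) * x i) \<partial>gaussian_vec) \<partial>?N)"
    by (rule P.Fubini_integral[symmetric], unfold case_prod_beta', rule integrable_iexp)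
       (auto intro: PP.finite_measure_axioms)
  also have "\<dots> = (\<integral>x. (\<integral>y. iexp ((\<Sum>i\<in>J. (s * x i) *\<^sub>R q i) \<bullet> y) \<partial>gaussian_vec) \<partial>?N)"
    by (simp add: inner_sum_left mult_ac)
  also have "\<dots> = (\<integral>x. of_real (exp (- t * (\<Sum>i\<in>J. (x i)\<^sup>2))) \<partial>?N)"
    unfolding integral_iexp_gaussian_vec sq
    by (simp add: power_mult_distrib s sum_distrib_left sum_divide_distrib sum_negf)
  finally have "of_real (\<integral>y. exp (- t * (\<Sum>i\<in>J. (q i \<bullet> y)\<^sup>2)) \<partial>gaussian_vec)
     = complex_of_real (\<integral>x. exp (- t * (\<Sum>i\<in>J. (x i)\<^sup>2)) \<partial>?N)"
    unfolding integral_complex_of_real .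
  then show ?thesis
    unfolding of_real_eq_iff using integral_exp_sum_squares_std_normal[OF t J] by simp
qed

section \<open>Gamma integrals\<close>

lemma nn_integral_Gamma_scaled:
  assumes a: "a > 0" and x: "x > (0::real)"
  shows "(\<integral>\<^sup>+t. ennreal (indicator {0..} t * t powr (a - 1) * exp (- (x * t))) \<partial>lborel)
    = ennreal (Gamma a * x powr - a)"
proof -
  let ?I = "\<integral>\<^sup>+t. ennreal (indicator {0..} t * t powr (a - 1) * exp (- (x * t))) \<partial>lborel"
  have "ennreal (Gamma a) = (\<integral>\<^sup>+t. ennreal (indicator {0..} t * t powr (a - 1) / exp t) \<partial>lborel)"
    using Gamma_conv_nn_integral_real[OF a] by simp
  also have "\<dots> = ennreal x * (\<integral>\<^sup>+t. ennreal (indicator {0..} (0 + x * t) * (0 + x * t) powr (a - 1) / exp (0 + x * t)) \<partial>lborel)"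
    using x by (subst nn_integral_real_affine[where c = x and t = 0]) auto
  also have "(\<integral>\<^sup>+t. ennreal (indicator {0..} (0 + x * t) * (0 + x * t) powr (a - 1) / exp (0 + x * t)) \<partial>lborel)
     = (\<integral>\<^sup>+t. ennreal (x powr (a - 1)) * ennreal (indicator {0..} t * t powr (a - 1) * exp (- (x * t))) \<partial>lborel)"
    using x by (intro nn_integral_cong)
      (auto simp: indicator_def powr_mult exp_minus field_simps zero_le_mult_iff simp flip: ennreal_mult')
  also have "\<dots> = ennreal (x powr (a - 1)) * ?I" by (rule nn_integral_cmult) measurable
  also have "ennreal x * \<dots> = ennreal (x powr a) * ?I"
    using x by (simp add: mult.assoc[symmetric] powr_mult_base flip: ennreal_mult')
  finally have "ennreal (x powr - a) * ennreal (Gamma a) = ennreal (x powr - a) * (ennreal (x powr a) * ?I)"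
    by simp
  also have "\<dots> = ?I"
    using x by (simp add: mult.assoc[symmetric] powr_add[symmetric] flip: ennreal_mult')
  finally show ?thesis using Gamma_real_pos[OF a] by (simp add: mult.commute ennreal_mult')
qed

text \<open>
  Divergence at \<open>x = 0\<close> of the integral in \<open>nn_integral_Gamma_scaled\<close>, from monotonicity in \<open>x\<close>. It
  is what rules out that a random \<open>x\<close> vanishes with positive probability.
\<close>

lemma nn_integral_Gamma_zero:
  assumes a: "a > (0::real)"
  shows "(\<integral>\<^sup>+t. ennreal (indicator {0..} t * t powr (a - 1)) \<partial>lborel) = \<infinity>"
proof (rule ccontr)
  let ?I = "\<integral>\<^sup>+t. ennreal (indicator {0..} t * t powr (a - 1)) \<partial>lborel"
  assume "?I \<noteq> \<infinity>"
  then obtain r where r: "r \<ge> 0" "?I = ennreal r" by (cases ?I) auto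
  have G: "Gamma a > 0" using a by (rule Gamma_real_pos)
  \<comment> \<open>Chosen such that the integral for \<open>x\<close> is \<open>r + 1\<close>.\<close>
  define x where "x = ((r + 1) / Gamma a) powr (- 1 / a)"
  have x: "x > 0" using r G by (auto simp: x_def)
  have "ennreal (Gamma a * x powr - a) \<le> ?I"
    unfolding nn_integral_Gamma_scaled[OF a x, symmetric]
    using x by (intro nn_integral_mono ennreal_leI) (auto simp: indicator_def intro!: mult_right_le_one_le)
  moreover have "x powr - a = (r + 1) / Gamma a"
    using a r G by (simp add: x_def powr_powr del: Gamma_real_pos)
  then have "Gamma a * x powr - a = r + 1" using G by simp
  ultimately show False using r by simp
qed

text \<open>
  Expand \<open>(1 + 2 * t) powr - b\<close> as a Gamma integral in a second variable \<open>u\<close> and integrate over \<open>t\<close>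
  first; both integrations are then instances of \<open>nn_integral_Gamma_scaled\<close>.
\<close>

lemma nn_integral_Beta_halfline:
  assumes a: "0 < a" and b: "a < (b::real)"
  shows "(\<integral>\<^sup>+t. ennreal (indicator {0..} t * t powr (a - 1) * (1 + 2 * t) powr - b) \<partial>lborel)
    = ennreal (2 powr - a * Gamma a * Gamma (b - a) / Gamma b)"
proof -
  let ?I = "\<integral>\<^sup>+t. ennreal (indicator {0..} t * t powr (a - 1) * (1 + 2 * t) powr - b) \<partial>lborel"
  define f where "f t u = indicator {0..} t * t powr (a - 1) * (indicator {0..} u * u powr (b - 1) * exp (- ((1 + 2 * t) * u)))" for t u :: real
  have G: "Gamma a > 0" "Gamma b > 0" "Gamma (b - a) > 0" using a b by (auto intro: Gamma_real_pos)
  have "ennreal (Gamma b) * ?I = (\<integral>\<^sup>+t. ennreal (Gamma b) * ennreal (indicator {0..} t * t powr (a - 1) * (1 + 2 * t) powr - b) \<partial>lborel)"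
    by (subst nn_integral_cmult) auto
  also have "\<dots> = (\<integral>\<^sup>+t. \<integral>\<^sup>+u. ennreal (f t u) \<partial>lborel \<partial>lborel)"
  proof (intro nn_integral_cong)
    fix t :: real
    show "ennreal (Gamma b) * ennreal (indicator {0..} t * t powr (a - 1) * (1 + 2 * t) powr - b) = (\<integral>\<^sup>+u. ennreal (f t u) \<partial>lborel)"
    proof (cases "t \<ge> 0")
      case True
      have "(\<integral>\<^sup>+u. ennreal (f t u) \<partial>lborel) = (\<integral>\<^sup>+u. ennreal (t powr (a - 1)) * ennreal (indicator {0..} u * u powr (b - 1) * exp (- ((1 + 2 * t) * u))) \<partial>lborel)"
        using True by (intro nn_integral_cong) (simp add: f_def ennreal_mult'[symmetric])
      also have "\<dots> = ennreal (t powr (a - 1)) * ennreal (Gamma b * (1 + 2 * t) powr - b)"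
        using a b True by (subst nn_integral_cmult) (auto simp: nn_integral_Gamma_scaled)
      finally show ?thesis using True G by (simp add: mult_ac flip: ennreal_mult')
    qed (simp add: f_def)
  qed
  also have "\<dots> = (\<integral>\<^sup>+u. \<integral>\<^sup>+t. ennreal (f t u) \<partial>lborel \<partial>lborel)"
    by (rule lborel_pair.Fubini') (auto simp: f_def case_prod_beta')
  also have "\<dots> = (\<integral>\<^sup>+u. ennreal (Gamma a * 2 powr - a) * ennreal (indicator {0..} u * u powr (b - a - 1) * exp (- (1 * u))) \<partial>lborel)"
  proof (intro nn_integral_cong_AE)
    have "AE u in lborel. u \<noteq> (0::real)" by (rule AE_lborel_singleton)
    then show "AE u in lborel. (\<integral>\<^sup>+t. ennreal (f t u) \<partial>lborel) =
        ennreal (Gamma a * 2 powr - a) * ennreal (indicator {0..} u * u powr (b - a - 1) * exp (- (1 * u)))"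
    proof eventually_elim
      case (elim u)
      show ?case
      proof (cases "u > 0")
        case True
        have "(\<integral>\<^sup>+t. ennreal (f t u) \<partial>lborel) = (\<integral>\<^sup>+t. ennreal (u powr (b - 1) * exp (- u)) * ennreal (indicator {0..} t * t powr (a - 1) * exp (- ((2 * u) * t))) \<partial>lborel)"
          using True by (intro nn_integral_cong) (simp add: f_def algebra_simps exp_add[symmetric] ennreal_mult'[symmetric])
        also have "\<dots> = ennreal (u powr (b - 1) * exp (- u)) * ennreal (Gamma a * (2 * u) powr - a)"
          using a True by (subst nn_integral_cmult) (auto simp: nn_integral_Gamma_scaled)
        also have "\<dots> = ennreal (Gamma a * 2 powr - a * ((u powr (b - 1) * u powr - a) * exp (- u)))"
          using True by (simp add: powr_mult mult_ac flip: ennreal_mult')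
        also have "u powr (b - 1) * u powr - a = u powr (b - a - 1)"
          by (simp add: powr_add[symmetric] algebra_simps)
        finally show ?thesis using True G by (simp flip: ennreal_mult')
      qed (use elim in \<open>auto simp: f_def\<close>)
    qed
  qed
  also have "\<dots> = ennreal (Gamma a * 2 powr - a) * ennreal (Gamma (b - a) * 1 powr - (b - a))"
    using nn_integral_Gamma_scaled[of "b - a" 1] b by (subst nn_integral_cmult) auto
  finally have *: "ennreal (Gamma b) * ?I = ennreal (Gamma a * 2 powr - a * Gamma (b - a))"
    using G by (simp flip: ennreal_mult')
  have "?I = ennreal (1 / Gamma b) * (ennreal (Gamma b) * ?I)"
    using G by (simp add: mult.assoc[symmetric] flip: ennreal_mult')
  also have "\<dots> = ennreal (2 powr - a * Gamma a * Gamma (b - a) / Gamma b)"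
    unfolding * using G by (simp add: mult_ac flip: ennreal_mult')
  finally show ?thesis .
qed

section \<open>Negative moments of the length of a projected Gaussian vector\<close>

text \<open>
  The moment of order \<open>- 2 * a\<close> of the chi distribution with \<open>m\<close> degrees of freedom, for
  \<open>0 < a < m / 2\<close>.
\<close>

definition chi_moment :: "real \<Rightarrow> nat \<Rightarrow> real" where
  "chi_moment a m = 2 powr - a * Gamma (real m / 2 - a) / Gamma (real m / 2)"

lemma chi_moment_nonneg:
  assumes "a < 1 / 2" "m \<ge> 1"
  shows "0 \<le> chi_moment a m"
proof -
  have "real m / 2 - a > 0" "real m / 2 > 0" using assms by auto
  from this[THEN Gamma_real_pos] show ?thesis by (simp add: chi_moment_def)
qed

text \<open>
  Multiply by \<open>Gamma a\<close>, write the power of the squared length \<open>R y\<close> as an integral of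
  \<open>t powr (a - 1) * exp (- (R y * t))\<close> and exchange the integrals. The inner integral is infinite
  where \<open>R y = 0\<close>, but the total is finite, so \<open>R\<close> vanishes only on a null set.
\<close>

lemma negative_moment_projection_gaussian_vec:
  fixes q :: "'n \<Rightarrow> real^'n"
  assumes a: "0 < a" "a < card J / 2"
    and q: "\<And>i j. i \<in> J \<Longrightarrow> j \<in> J \<Longrightarrow> q i \<bullet> q j = (if i = j then 1 else 0)"
  shows "(\<integral>\<^sup>+y. ennreal ((\<Sum>i\<in>J. (q i \<bullet> y)\<^sup>2) powr - a) \<partial>gaussian_vec) = ennreal (chi_moment a (card J))"
proof -
  define R where "R y = (\<Sum>i\<in>J. (q i \<bullet> y)\<^sup>2)" for y
  define b where "b = card J / 2"
  have [measurable]: "R \<in> borel_measurable borel" unfolding R_def by measurable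
  have R0: "R y \<ge> 0" for y by (simp add: R_def sum_nonneg)
  have G: "Gamma a > 0" "Gamma b > 0" "Gamma (b - a) > 0" using a by (auto simp: b_def intro!: Gamma_real_pos)
  define g where "g y t = indicator {0..} t * t powr (a - 1) * exp (- (R y * t))" for y and t :: real
  interpret P: pair_sigma_finite gaussian_vec lborel
    by (intro pair_sigma_finite.intro) (auto intro: prob_space_imp_sigma_finite gaussian_vec.prob_space_axioms sigma_finite_lborel)
  have lap: "(\<integral>\<^sup>+y. ennreal (exp (- (R y * t))) \<partial>gaussian_vec) = ennreal ((1 + 2 * t) powr - b)" if "t \<ge> 0" for t
  proof -
    have "(\<integral>\<^sup>+y. ennreal (exp (- (R y * t))) \<partial>gaussian_vec) = ennreal (\<integral>y. exp (- (R y * t)) \<partial>gaussian_vec)"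
      using that R0 by (intro nn_integral_eq_integral gaussian_vec.integrable_const_bound[where B = 1]) auto
    also have "(\<integral>y. exp (- (R y * t)) \<partial>gaussian_vec) = (1 + 2 * t) powr - b"
      using laplace_projection_gaussian_vec[OF that q] by (simp add: R_def b_def mult.commute)
    finally show ?thesis .
  qed
  have "(\<integral>\<^sup>+y. \<integral>\<^sup>+t. ennreal (g y t) \<partial>lborel \<partial>gaussian_vec) = (\<integral>\<^sup>+t. \<integral>\<^sup>+y. ennreal (g y t) \<partial>gaussian_vec \<partial>lborel)"
    by (rule P.Fubini'[symmetric]) (auto simp: g_def case_prod_beta')
  also have "\<dots> = (\<integral>\<^sup>+t. ennreal (indicator {0..} t * t powr (a - 1) * (1 + 2 * t) powr - b) \<partial>lborel)"
  proof (intro nn_integral_cong)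
    fix t :: real
    show "(\<integral>\<^sup>+y. ennreal (g y t) \<partial>gaussian_vec) = ennreal (indicator {0..} t * t powr (a - 1) * (1 + 2 * t) powr - b)"
    proof (cases "t \<ge> 0")
      case True
      have "(\<integral>\<^sup>+y. ennreal (g y t) \<partial>gaussian_vec) = (\<integral>\<^sup>+y. ennreal (t powr (a - 1)) * ennreal (exp (- (R y * t))) \<partial>gaussian_vec)"
        using True by (intro nn_integral_cong) (simp add: g_def ennreal_mult'[symmetric])
      also have "\<dots> = ennreal (t powr (a - 1)) * ennreal ((1 + 2 * t) powr - b)"
        using lap[OF True] by (subst nn_integral_cmult) auto
      finally show ?thesis using True by (simp flip: ennreal_mult')
    qed (simp add: g_def)
  qed
  also have "\<dots> = ennreal (2 powr - a * Gamma a * Gamma (b - a) / Gamma b)"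
    using a by (intro nn_integral_Beta_halfline) (auto simp: b_def)
  finally have *: "(\<integral>\<^sup>+y. \<integral>\<^sup>+t. ennreal (g y t) \<partial>lborel \<partial>gaussian_vec) = ennreal (2 powr - a * Gamma a * Gamma (b - a) / Gamma b)" .
  have "AE y in gaussian_vec. (\<integral>\<^sup>+t. ennreal (g y t) \<partial>lborel) \<noteq> \<infinity>"
    using * by (intro nn_integral_PInf_AE) (auto simp: g_def)
  then have AE: "AE y in gaussian_vec. (\<integral>\<^sup>+t. ennreal (g y t) \<partial>lborel) = ennreal (Gamma a) * ennreal (R y powr - a)"
  proof eventually_elim
    case (elim y)
    have "R y \<noteq> 0"
    proof
      assume "R y = 0"
      then have "(\<integral>\<^sup>+t. ennreal (g y t) \<partial>lborel) = \<infinity>"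
        using nn_integral_Gamma_zero[OF a(1)] by (simp add: g_def)
      with elim show False by simp
    qed
    with R0[of y] have "R y > 0" by simp
    from nn_integral_Gamma_scaled[OF a(1) this] show ?case
      using G by (simp add: g_def ennreal_mult')
  qed
  have "ennreal (Gamma a) * (\<integral>\<^sup>+y. ennreal (R y powr - a) \<partial>gaussian_vec) = (\<integral>\<^sup>+y. ennreal (Gamma a) * ennreal (R y powr - a) \<partial>gaussian_vec)"
    by (subst nn_integral_cmult) auto
  also have "\<dots> = (\<integral>\<^sup>+y. \<integral>\<^sup>+t. ennreal (g y t) \<partial>lborel \<partial>gaussian_vec)"
    using AE by (intro nn_integral_cong_AE) (auto elim!: eventually_mono)
  finally have "ennreal (1 / Gamma a) * (ennreal (Gamma a) * (\<integral>\<^sup>+y. ennreal (R y powr - a) \<partial>gaussian_vec))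
     = ennreal (1 / Gamma a) * ennreal (2 powr - a * Gamma a * Gamma (b - a) / Gamma b)"
    using * by simp
  moreover have "ennreal (1 / Gamma a) * (ennreal (Gamma a) * X) = X" for X
    using G(1) by (simp add: mult.assoc[symmetric] ennreal_mult'[symmetric] del: Gamma_real_pos)
  ultimately show ?thesis
    using G by (simp add: R_def b_def chi_moment_def ennreal_mult'[symmetric])
qed

section \<open>Moments of the determinant of a Gaussian matrix\<close>

lemma orthogonal_matrix_inner_rows:
  fixes Q :: "real^'n^'n"
  shows "orthogonal_matrix Q \<longleftrightarrow> (\<forall>i j. Q $ i \<bullet> Q $ j = (if i = j then 1 else 0))"
proof -
  have "orthogonal_matrix Q \<longleftrightarrow> Q ** transpose Q = mat 1"
    using matrix_left_right_inverse by (auto simp: orthogonal_matrix_def)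
  also have "\<dots> \<longleftrightarrow> (\<forall>i j. Q $ i \<bullet> Q $ j = (if i = j then 1 else 0))"
    by (simp add: vec_eq_iff matrix_matrix_mult_def transpose_def mat_def inner_vec_def)
  finally show ?thesis .
qed

lemma orthogonal_matrix_expansion:
  fixes Q :: "real^'n^'n"
  assumes "orthogonal_matrix Q"
  shows "(\<Sum>i\<in>UNIV. (Q $ i \<bullet> y) *\<^sub>R Q $ i) = y"
proof -
  have "transpose Q *v (Q *v y) = y"
    using assms by (simp add: orthogonal_matrix_def matrix_vector_mul_assoc del: transpose_matrix_vector)
  moreover have "transpose Q *v (Q *v y) = (\<Sum>i\<in>UNIV. (Q $ i \<bullet> y) *\<^sub>R Q $ i)"
    by (simp add: vec_eq_iff matrix_vector_mult_def transpose_def inner_vec_def mult.commute del: transpose_matrix_vector)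
  ultimately show ?thesis by simp
qed

text \<open>
  The Householder reflection that exchanges \<open>Q $ k\<close> and \<open>u\<close> fixes every row that is orthogonal to
  both. When \<open>Q $ k = u\<close>, division by zero turns the formula into the identity.
\<close>

lemma orthogonal_matrix_replace_row:
  fixes Q :: "real^'n^'n"
  assumes Q: "orthogonal_matrix Q" and u: "u \<bullet> u = 1" and J: "\<And>i. i \<notin> J \<Longrightarrow> Q $ i \<bullet> u = 0" and k: "k \<in> J"
  obtains Q' where "orthogonal_matrix Q'" "Q' $ k = u" "\<And>i. i \<notin> J \<Longrightarrow> Q' $ i = Q $ i"
proof -
  have q: "Q $ i \<bullet> Q $ j = (if i = j then 1 else 0)" for i j
    using Q by (auto simp: orthogonal_matrix_inner_rows)
  define v where "v = Q $ k - u"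
  define H where "H x = x - (2 * (x \<bullet> v) / (v \<bullet> v)) *\<^sub>R v" for x
  have HH: "H x \<bullet> H y = x \<bullet> y" for x y
  proof (cases "v = 0")
    case False
    have "H x \<bullet> H y = x \<bullet> y - 2 * (x \<bullet> v) * (y \<bullet> v) / (v \<bullet> v) - 2 * (x \<bullet> v) * (y \<bullet> v) / (v \<bullet> v)
        + (2 * (x \<bullet> v) / (v \<bullet> v)) * (2 * (y \<bullet> v) / (v \<bullet> v)) * (v \<bullet> v)"
      by (simp add: H_def inner_diff_left inner_diff_right inner_commute algebra_simps)
    then show ?thesis using False by simp
  qed (simp add: H_def)
  have Hk: "H (Q $ k) = u"
  proof (cases "v = 0")
    case False
    have "v \<bullet> v = 2 * (Q $ k \<bullet> v)"
      using q[of k k] u by (simp add: v_def inner_diff_left inner_diff_right inner_commute)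
    moreover have "v \<bullet> v \<noteq> 0" using False by simp
    ultimately have "2 * (Q $ k \<bullet> v) / (v \<bullet> v) = 1" by (metis divide_self)
    then have "H (Q $ k) = Q $ k - v" by (simp only: H_def scaleR_one)
    then show ?thesis by (simp add: v_def)
  qed (simp add: H_def v_def)
  have HJ: "H (Q $ i) = Q $ i" if "i \<notin> J" for i
  proof -
    have "Q $ i \<bullet> v = 0" using that k q[of i k] J[of i] by (auto simp: v_def inner_diff_right)
    then show ?thesis by (simp add: H_def)
  qed
  show thesis
    by (rule that[of "\<chi> i. H (Q $ i)"]) (auto simp: orthogonal_matrix_inner_rows HH q Hk HJ)
qed

text \<open>
  Row operations with the rows of \<open>Q\<close> outside \<open>insert k J\<close> remove the components of row \<open>k\<close> along them.
\<close>

lemma det_replace_row_projection: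
  fixes Q :: "real^'n^'n" and x :: "'n \<Rightarrow> real^'n"
  assumes Q: "orthogonal_matrix Q" and k: "k \<notin> J"
  defines "A z \<equiv> (\<chi> i. if i = k then z else if i \<in> J then x i else Q $ i)"
  shows "det (A y) = det (A (\<Sum>i\<in>insert k J. (Q $ i \<bullet> y) *\<^sub>R Q $ i))"
proof -
  define w where "w = (\<Sum>i\<in>insert k J. (Q $ i \<bullet> y) *\<^sub>R Q $ i)"
  define z where "z = (\<Sum>i\<in>- insert k J. (Q $ i \<bullet> y) *\<^sub>R Q $ i)"
  have "y = (\<Sum>i\<in>UNIV. (Q $ i \<bullet> y) *\<^sub>R Q $ i)"
    using orthogonal_matrix_expansion[OF Q] by simp
  also have "\<dots> = w + z"
    unfolding w_def z_def by (subst sum.union_disjoint[symmetric]) (auto simp del: sum.insert)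
  finally have y: "y = w + z" .
  have "z \<in> vec.span {row j (A w) |j. j \<noteq> k}"
    unfolding z_def scalar_mult_eq_scaleR[symmetric]
  proof (intro vec.span_sum vec.span_scale vec.span_base CollectI)
    fix i assume "i \<in> - insert k J"
    then show "\<exists>j. Q $ i = row j (A w) \<and> j \<noteq> k"
      by (intro exI[of _ i]) (auto simp: A_def row_def vec_eq_iff)
  qed
  from det_row_span[OF this]
  have "det (A w) = det (\<chi> i. if i = k then row k (A w) + z else row i (A w))" by simp
  also have "(\<chi> i. if i = k then row k (A w) + z else row i (A w)) = A y"
    by (auto simp: A_def row_def vec_eq_iff y)
  finally show ?thesis by (simp add: w_def)
qed

lemma borel_measurable_det_rows[measurable]:
  fixes Q :: "real^'n^'n"
  shows "(\<lambda>x. det (\<chi> i. if i \<in> J then x i else Q $ i)) \<in> borel_measurable (\<Pi>\<^sub>M i\<in>J. borel)"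
proof (rule borel_measurable_det)
  fix i j
  show "(\<lambda>x. (\<chi> i. if i \<in> J then x i else Q $ i) $ i $ j) \<in> borel_measurable (\<Pi>\<^sub>M i\<in>J. borel)"
    by (cases "i \<in> J") auto
qed

text \<open>
  The rows in \<open>J\<close> are random and the others are fixed orthonormal vectors. Adding a random row \<open>y\<close>
  to \<open>J\<close>: integrate over it last. Only its projection \<open>w y\<close> orthogonal to the fixed rows matters. By
  homogeneity the determinant is the length of that projection times the one with the unit vector
  \<open>u\<close> as row \<open>k\<close>, and \<open>u\<close> extends the fixed rows to a larger orthonormal system, to which the
  induction hypothesis applies. Stating the claim for every orthogonal \<open>Q\<close> is what makes the inner
  integral independent of the direction of \<open>w y\<close>.
\<close>

lemma det_moment_induct:
  fixes Q :: "real^'n^'n" and J :: "'n set"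
  assumes a: "0 < a" "a < 1 / 2" and Q: "orthogonal_matrix Q"
  shows "(\<integral>\<^sup>+x. ennreal (\<bar>det (\<chi> i. if i \<in> J then x i else Q $ i)\<bar> powr (- 2 * a)) \<partial>(\<Pi>\<^sub>M i\<in>J. gaussian_vec))
    = (\<Prod>m = 1..card J. ennreal (chi_moment a m))"
proof -
  have "finite J" by simp
  then show ?thesis using Q
  proof (induction J arbitrary: Q)
    case empty
    have "\<bar>det Q\<bar> = 1" using det_orthogonal_matrix[OF empty] by auto
    then show ?case by (simp add: space_PiM)
  next
    case (insert k J)
    note Q = insert.prems
    have q: "Q $ i \<bullet> Q $ j = (if i = j then 1 else 0)" for i j
      using Q by (auto simp: orthogonal_matrix_inner_rows)
    let ?P = "\<Prod>m = 1..card J. ennreal (chi_moment a m)"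
    define A where "A x z = (\<chi> i. if i = k then z else if i \<in> J then x i else Q $ i)" for x z
    define R where "R y = (\<Sum>i\<in>insert k J. (Q $ i \<bullet> y)\<^sup>2)" for y
    define w where "w y = (\<Sum>i\<in>insert k J. (Q $ i \<bullet> y) *\<^sub>R Q $ i)" for y
    have wR: "w y \<bullet> w y = R y" for y
    proof -
      have "w y \<bullet> w y = (\<Sum>i\<in>insert k J. \<Sum>j\<in>insert k J. (Q $ i \<bullet> y) * (Q $ j \<bullet> y) * (Q $ j \<bullet> Q $ i))"
        unfolding w_def inner_sum_left inner_sum_right by (simp only: inner_scaleR_left inner_scaleR_right mult_ac)
      also have "\<dots> = R y"
        unfolding R_def q using \<open>finite J\<close> 
        by (intro sum.cong refl) (simp add: if_distrib power2_eq_square sum.delta' del: sum.insert cong: if_cong)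
      finally show ?thesis .
    qed
    have detw: "det (A x y) = det (A x (w y))" for x y
      unfolding A_def w_def by (rule det_replace_row_projection[OF Q \<open>k \<notin> J\<close>])
    have inner: "(\<integral>\<^sup>+x. ennreal (\<bar>det (A x y)\<bar> powr (- 2 * a)) \<partial>(\<Pi>\<^sub>M i\<in>J. gaussian_vec)) = ennreal (R y powr - a) * ?P" for y
    proof (cases "w y = 0")
      case True
      then have "R y = 0" using wR[of y] by simp
      \<comment> \<open>Both sides are \<open>0\<close>, as \<open>0 powr p = 0\<close>.\<close>
      moreover have "det (A x y) = 0" for x
        by (subst detw) (simp add: True A_def det_row_0)
      ultimately show ?thesis by simp
    next
      case False
      define r where "r = norm (w y)"
      have r: "r > 0" "r\<^sup>2 = R y" using False wR[of y] by (auto simp: r_def power2_norm_eq_inner)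
      define u where "u = (1 / r) *\<^sub>R w y"
      have "u \<bullet> u = 1" using r(1) by (simp add: u_def wR r(2)[symmetric] power2_eq_square)
      moreover have "Q $ i \<bullet> u = 0" if "i \<notin> insert k J" for i
        unfolding u_def w_def inner_scaleR_right inner_sum_right using that
        by (intro mult_eq_0_iff[THEN iffD2] disjI2 sum.neutral) (auto simp: q)
      ultimately obtain Q' where Q': "orthogonal_matrix Q'" "Q' $ k = u" "\<And>i. i \<notin> insert k J \<Longrightarrow> Q' $ i = Q $ i"
        using orthogonal_matrix_replace_row[OF Q, of u "insert k J" k] by blast
      have det: "det (A x y) = r * det (\<chi> i. if i \<in> J then x i else Q' $ i)" for x
      proof -
        have "det (A x y) = det (A x (r *s u))"
          unfolding detw[of x y] using r by (simp add: u_def scalar_mult_eq_scaleR)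
        also have "\<dots> = r * det (A x u)"
          unfolding A_def by (rule det_row_mul)
        also have "A x u = (\<chi> i. if i \<in> J then x i else Q' $ i)"
          using Q' \<open>k \<notin> J\<close> by (auto simp: A_def vec_eq_iff)
        finally show ?thesis .
      qed
      have "r powr (- 2 * a) = R y powr - a"
        unfolding r(2)[symmetric] using r(1) by (simp add: powr_powr flip: powr_numeral)
      then have "(\<integral>\<^sup>+x. ennreal (\<bar>det (A x y)\<bar> powr (- 2 * a)) \<partial>(\<Pi>\<^sub>M i\<in>J. gaussian_vec))
        = (\<integral>\<^sup>+x. ennreal (R y powr - a) * ennreal (\<bar>det (\<chi> i. if i \<in> J then x i else Q' $ i)\<bar> powr (- 2 * a)) \<partial>(\<Pi>\<^sub>M i\<in>J. gaussian_vec))"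
        using r(1) by (intro nn_integral_cong) (simp add: det abs_mult powr_mult ennreal_mult')
      also have "\<dots> = ennreal (R y powr - a) * ?P"
        unfolding insert.IH[OF Q'(1), symmetric] by (rule nn_integral_cmult) measurable
      finally show ?thesis .
    qed
    have "(\<integral>\<^sup>+x. ennreal (\<bar>det (\<chi> i. if i \<in> insert k J then x i else Q $ i)\<bar> powr (- 2 * a)) \<partial>(\<Pi>\<^sub>M i\<in>insert k J. gaussian_vec))
      = (\<integral>\<^sup>+y. \<integral>\<^sup>+x. ennreal (\<bar>det (\<chi> i. if i \<in> insert k J then (x(k := y)) i else Q $ i)\<bar> powr (- 2 * a)) \<partial>(\<Pi>\<^sub>M i\<in>J. gaussian_vec) \<partial>gaussian_vec)"
      by (rule gaussian_rows.product_nn_integral_insert_rev[OF insert.hyps(1,2)]) measurable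
    also have "\<dots> = (\<integral>\<^sup>+y. \<integral>\<^sup>+x. ennreal (\<bar>det (A x y)\<bar> powr (- 2 * a)) \<partial>(\<Pi>\<^sub>M i\<in>J. gaussian_vec) \<partial>gaussian_vec)"
    proof -
      have "(\<chi> i. if i \<in> insert k J then (x(k := y)) i else Q $ i) = A x y" for x y
        by (auto simp: A_def vec_eq_iff)
      then show ?thesis by simp
    qed
    also have "\<dots> = (\<integral>\<^sup>+y. ennreal (R y powr - a) \<partial>gaussian_vec) * ?P"
      unfolding inner R_def by (rule nn_integral_multc) measurable
    also have "(\<integral>\<^sup>+y. ennreal (R y powr - a) \<partial>gaussian_vec) = ennreal (chi_moment a (card (insert k J)))"
      unfolding R_def
    proof (rule negative_moment_projection_gaussian_vec)
      have "real (card (insert k J)) \<ge> 1" using insert.hyps by simp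
      then show "a < card (insert k J) / 2" using a by simp
    qed (use a q in auto)
    also have "\<dots> * ?P = (\<Prod>m = 1..card (insert k J). ennreal (chi_moment a m))"
      using insert.hyps by (simp add: mult.commute)
    finally show ?case .
  qed
qed

text \<open>
  Grouping the independent entries by rows.
\<close>

lemma distr_row_std_gaussian_matrix:
  fixes X :: "'w \<Rightarrow> real^'n^'n"
  assumes M: "prob_space M" and X: "std_gaussian_matrix M X"
  shows "distr M (\<Pi>\<^sub>M i\<in>UNIV. borel) (\<lambda>\<omega>. \<lambda>i\<in>UNIV. X \<omega> $ i) = (\<Pi>\<^sub>M i\<in>UNIV. gaussian_vec)"
proof -
  interpret prob_space M by fact
  have ind: "indep_vars (\<lambda>_. borel) (\<lambda>(i, j) \<omega>. X \<omega> $ i $ j) UNIV"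
    and dist: "distributed M lborel (\<lambda>\<omega>. X \<omega> $ i $ j) std_normal_density" for i j
    using X by (auto simp: std_gaussian_matrix_def)
  have distr: "distr M borel (\<lambda>\<omega>. X \<omega> $ i $ j) = std_normal_distribution" for i j
    using distributed_distr_eq_density[OF dist, of i j] by (simp cong: distr_cong)
  have entry[measurable]: "(\<lambda>\<omega>. X \<omega> $ i $ j) \<in> borel_measurable M" for i j
    using distributed_measurable[OF dist, of i j] by simp
  have row[measurable]: "(\<lambda>\<omega>. X \<omega> $ i) \<in> borel_measurable M" for i
    by (simp add: borel_measurable_vec_iff)
  have rowdistr: "distr M borel (\<lambda>\<omega>. X \<omega> $ i) = gaussian_vec" for i
  proof -
    have "indep_vars (\<lambda>j. borel) (\<lambda>j. (\<lambda>f. f (i, j)) \<circ> (\<lambda>\<omega>. restrict (\<lambda>p. (\<lambda>(i, j) \<omega>. X \<omega> $ i $ j) p \<omega>) {(i, j)})) UNIV"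
      by (rule indep_vars_compose[OF indep_vars_restrict[OF ind]]) (auto simp: disjoint_family_on_def)
    then have "indep_vars (\<lambda>_. borel) (\<lambda>j \<omega>. X \<omega> $ i $ j) UNIV" by (simp add: comp_def)
    then have *: "distr M (\<Pi>\<^sub>M j\<in>UNIV. borel) (\<lambda>\<omega>. \<lambda>j\<in>UNIV. X \<omega> $ i $ j) = (\<Pi>\<^sub>M j\<in>UNIV. std_normal_distribution)"
      by (subst (asm) indep_vars_iff_distr_eq_PiM) (auto simp: distr)
    have "gaussian_vec = distr (distr M (\<Pi>\<^sub>M j\<in>UNIV. borel) (\<lambda>\<omega>. \<lambda>j\<in>UNIV. X \<omega> $ i $ j)) borel (\<lambda>f. \<chi> i. f i)"
      unfolding gaussian_vec_def * ..
    also have "\<dots> = distr M borel (\<lambda>\<omega>. X \<omega> $ i)"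
    proof -
      have 1: "(\<lambda>\<omega>. \<lambda>j\<in>UNIV. X \<omega> $ i $ j) \<in> measurable M (\<Pi>\<^sub>M j\<in>UNIV. borel)" by measurable
      have 2: "(\<lambda>f. \<chi> i. f i) \<in> borel_measurable (\<Pi>\<^sub>M j\<in>(UNIV :: 'n set). (borel :: real measure))"
        by (simp add: borel_measurable_vec_iff)
      show ?thesis by (subst distr_distr[OF 2 1]) (simp add: comp_def restrict_UNIV vec_nth_inverse)
    qed
    finally show ?thesis ..
  qed
  have "indep_vars (\<lambda>i. borel) (\<lambda>i. (\<lambda>f. \<chi> j. f (i, j)) \<circ> (\<lambda>\<omega>. restrict (\<lambda>p. (\<lambda>(i, j) \<omega>. X \<omega> $ i $ j) p \<omega>) ({i} \<times> UNIV))) UNIV"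
  proof (rule indep_vars_compose[OF indep_vars_restrict[OF ind]])
    show "(\<lambda>f. \<chi> j. f (i, j)) \<in> borel_measurable (\<Pi>\<^sub>M p\<in>{i} \<times> (UNIV :: 'n set). (borel :: real measure))" for i :: 'n
      unfolding borel_measurable_vec_iff vec_lambda_beta
      by (intro allI measurable_component_singleton) simp
  qed (auto simp: disjoint_family_on_def)
  then have "indep_vars (\<lambda>i. borel) (\<lambda>i \<omega>. X \<omega> $ i) UNIV" by (simp add: comp_def)
  then show ?thesis
    by (subst (asm) indep_vars_iff_distr_eq_PiM) (auto simp: rowdistr)
qed

lemma nn_integral_det_std_gaussian_matrix:
  fixes X :: "'w \<Rightarrow> real^'n^'n"
  assumes M: "prob_space M" and X: "std_gaussian_matrix M X" and a: "0 < a" "a < 1 / 2"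
  shows "(\<integral>\<^sup>+\<omega>. ennreal (\<bar>det (X \<omega>)\<bar> powr (- 2 * a)) \<partial>M) = ennreal (\<Prod>m = 1..CARD('n). chi_moment a m)"
proof -
  have [measurable]: "(\<lambda>\<omega>. X \<omega> $ i) \<in> borel_measurable M" for i
    unfolding borel_measurable_vec_iff
  proof
    fix j
    have "distributed M lborel (\<lambda>\<omega>. X \<omega> $ i $ j) std_normal_density"
      using X by (auto simp: std_gaussian_matrix_def)
    from distributed_measurable[OF this] show "(\<lambda>\<omega>. X \<omega> $ i $ j) \<in> borel_measurable M" by simp
  qed
  have "(\<integral>\<^sup>+\<omega>. ennreal (\<bar>det (X \<omega>)\<bar> powr (- 2 * a)) \<partial>M)
     = (\<integral>\<^sup>+x. ennreal (\<bar>det (\<chi> i. if i \<in> UNIV then x i else mat 1 $ i)\<bar> powr (- 2 * a))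
          \<partial>distr M (\<Pi>\<^sub>M i\<in>UNIV. borel) (\<lambda>\<omega>. \<lambda>i\<in>UNIV. X \<omega> $ i))"
  proof (subst nn_integral_distr)
    show "(\<lambda>\<omega>. \<lambda>i\<in>UNIV. X \<omega> $ i) \<in> measurable M (\<Pi>\<^sub>M i\<in>UNIV. borel)" by (rule measurable_restrict) measurable
    have "(\<lambda>x. ennreal (\<bar>det (\<chi> i. if i \<in> UNIV then x i else mat 1 $ i)\<bar> powr (- 2 * a)))
        \<in> borel_measurable (\<Pi>\<^sub>M i\<in>UNIV. (borel :: (real^'n) measure))"
      by measurable
    then show "(\<lambda>x. ennreal (\<bar>det (\<chi> i. if i \<in> UNIV then x i else mat 1 $ i)\<bar> powr (- 2 * a)))
        \<in> borel_measurable (distr M (\<Pi>\<^sub>M i\<in>UNIV. (borel :: (real^'n) measure)) (\<lambda>\<omega>. \<lambda>i\<in>UNIV. X \<omega> $ i))"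
      by (simp only: measurable_distr_eq1)
  qed (simp_all add: restrict_UNIV vec_nth_inverse)
  also have "\<dots> = (\<Prod>m = 1..CARD('n). ennreal (chi_moment a m))"
    unfolding distr_row_std_gaussian_matrix[OF M X]
    using a by (intro det_moment_induct) (auto simp: orthogonal_matrix_id)
  also have "\<dots> = ennreal (\<Prod>m = 1..CARD('n). chi_moment a m)"
    using a by (intro prod_ennreal chi_moment_nonneg) auto
  finally show ?thesis .
qed

section \<open>Limits of the moments\<close>

lemma tendsto_power_at_one:
  fixes g :: "real \<Rightarrow> real"
  assumes g: "(g has_real_derivative D) (at 0)" and g0: "g 0 = 1" and c: "c > 0"
  shows "(\<lambda>N. g (c / real N) ^ N) \<longlonglongrightarrow> exp (c * D)"
proof -
  have lim: "filterlim (\<lambda>N. c / real N) (at 0) sequentially"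
    using c by (auto simp: filterlim_at intro!: tendsto_divide_0[OF tendsto_const] filterlim_at_top_imp_at_infinity
      filterlim_real_sequentially eventually_sequentiallyI[of 1])
  have "((\<lambda>x. ln (g x)) has_real_derivative D) (at 0)"
    using g by (auto intro!: derivative_eq_intros simp: g0)
  then have "((\<lambda>x. ln (g x) / x) \<longlongrightarrow> D) (at 0)"
    by (simp add: has_field_derivative_iff g0)
  from filterlim_compose[OF this lim]
  have "(\<lambda>N. c * (ln (g (c / real N)) / (c / real N))) \<longlonglongrightarrow> c * D"
    by (intro tendsto_intros)
  then have "(\<lambda>N. exp (c * (ln (g (c / real N)) / (c / real N)))) \<longlonglongrightarrow> exp (c * D)"
    by (rule tendsto_exp)
  moreover have "\<forall>\<^sub>F N in sequentially. exp (c * (ln (g (c / real N)) / (c / real N))) = g (c / real N) ^ N"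
  proof -
    have "isCont g 0" using g by (rule DERIV_isCont)
    then have "(g \<longlongrightarrow> 1) (at 0)" by (simp add: isCont_def g0)
    from filterlim_compose[OF this lim] have "\<forall>\<^sub>F N in sequentially. g (c / real N) > 0"
      by (rule order_tendstoD) simp
    then show ?thesis
    proof eventually_elim
      case (elim N)
      then show ?case using c by (simp add: exp_of_nat2_mult)
    qed
  qed
  ultimately show ?thesis by (rule Lim_transform_eventually)
qed

lemma chi_moment_deriv:
  assumes "m > 0"
  shows "((\<lambda>a. chi_moment a m) has_real_derivative - (ln 2 + Digamma (real m / 2))) (at 0)"
proof -
  have "Gamma (real m / 2) > 0" "real m / 2 \<notin> \<int>\<^sub>\<le>\<^sub>0" using assms by (auto intro: Gamma_real_pos)
  then show ?thesis unfolding chi_moment_def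
    by (auto intro!: derivative_eq_intros simp: field_simps)
qed

lemma chi_moment_0:
  assumes "m > 0"
  shows "chi_moment 0 m = 1"
proof -
  have "Gamma (real m / 2) > 0" using assms by (intro Gamma_real_pos) simp
  then show ?thesis by (simp add: chi_moment_def)
qed

lemma chi_moment_prod_deriv:
  "((\<lambda>a. \<Prod>m = 1..n. chi_moment a m) has_real_derivative - (\<Sum>m = 1..n. ln 2 + Digamma (real m / 2))) (at 0)"
proof (induction n)
  case (Suc n)
  have "(\<Prod>m = 1..n. chi_moment 0 m) = 1" by (intro prod.neutral) (auto simp: chi_moment_0)
  then show ?case
    using DERIV_mult[OF Suc chi_moment_deriv[of "Suc n"]] by (simp add: chi_moment_0 algebra_simps)
qed simp

lemma chi_moment_prod_limit:
  assumes "c > 0"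
  shows "(\<lambda>N. (\<Prod>m = 1..n. chi_moment (c / real N) m) ^ N)
    \<longlonglongrightarrow> exp (- c * (\<Sum>m = 1..n. ln 2 + Digamma (real m / 2)))"
  using tendsto_power_at_one[OF chi_moment_prod_deriv _ assms, of n]
  by (simp add: chi_moment_0)

section \<open>The sum of the Lyapunov exponents\<close>

text \<open>
  The second moment of \<open>Y N - y\<close> tends to \<open>y\<^sup>2 - 2 * y * y + y\<^sup>2 = 0\<close>, and by Fatou's lemma it bounds
  \<open>(L - y)\<^sup>2\<close> in the limit.
\<close>

lemma (in prob_space) AE_limit_eq_of_moments:
  fixes Y :: "nat \<Rightarrow> 'a \<Rightarrow> real"
  assumes Y: "\<And>N. Y N \<in> borel_measurable M"
    and lim: "AE \<omega> in M. (\<lambda>N. Y N \<omega>) \<longlonglongrightarrow> L"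
    and 1: "\<forall>\<^sub>F N in sequentially. has_bochner_integral M (Y N) (e1 N)" "e1 \<longlonglongrightarrow> y"
    and 2: "\<forall>\<^sub>F N in sequentially. has_bochner_integral M (\<lambda>\<omega>. (Y N \<omega>)\<^sup>2) (e2 N)" "e2 \<longlonglongrightarrow> y\<^sup>2"
  shows "L = y"
proof -
  note [measurable] = Y
  have "ennreal ((L - y)\<^sup>2) = (\<integral>\<^sup>+\<omega>. ennreal ((L - y)\<^sup>2) \<partial>M)" by (simp add: emeasure_space_1)
  also have "\<dots> = (\<integral>\<^sup>+\<omega>. liminf (\<lambda>N. ennreal ((Y N \<omega> - y)\<^sup>2)) \<partial>M)"
  proof (rule nn_integral_cong_AE)
    show "AE \<omega> in M. ennreal ((L - y)\<^sup>2) = liminf (\<lambda>N. ennreal ((Y N \<omega> - y)\<^sup>2))"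
      using lim
    proof eventually_elim
      case (elim \<omega>)
      have "(\<lambda>N. ennreal ((Y N \<omega> - y)\<^sup>2)) \<longlonglongrightarrow> ennreal ((L - y)\<^sup>2)"
        by (intro tendsto_ennrealI tendsto_intros elim)
      then show ?case by (intro lim_imp_Liminf[symmetric]) auto
    qed
  qed
  also have "\<dots> \<le> liminf (\<lambda>N. \<integral>\<^sup>+\<omega>. ennreal ((Y N \<omega> - y)\<^sup>2) \<partial>M)"
    by (rule nn_integral_liminf) measurable
  also have "\<dots> = liminf (\<lambda>N. ennreal (e2 N - 2 * y * e1 N + y\<^sup>2))"
  proof (rule Liminf_eq)
    show "\<forall>\<^sub>F N in sequentially. (\<integral>\<^sup>+\<omega>. ennreal ((Y N \<omega> - y)\<^sup>2) \<partial>M) = ennreal (e2 N - 2 * y * e1 N + y\<^sup>2)"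
      using 1(1) 2(1)
    proof eventually_elim
      case (elim N)
      have "has_bochner_integral M (\<lambda>\<omega>. (Y N \<omega>)\<^sup>2 - 2 * y * Y N \<omega> + y\<^sup>2) (e2 N - 2 * y * e1 N + y\<^sup>2)"
        by (intro has_bochner_integral_add has_bochner_integral_diff has_bochner_integral_mult_right elim)
           (simp add: has_bochner_integral_iff prob_space)
      then have "has_bochner_integral M (\<lambda>\<omega>. (Y N \<omega> - y)\<^sup>2) (e2 N - 2 * y * e1 N + y\<^sup>2)"
        by (simp add: power2_diff algebra_simps)
      then show ?case
        by (metis has_bochner_integral_iff nn_integral_eq_integral AE_I2 zero_le_power2)
    qed
  qed
  also have "\<dots> = 0"
  proof -
    have "(\<lambda>N. ennreal (e2 N - 2 * y * e1 N + y\<^sup>2)) \<longlonglongrightarrow> ennreal (y\<^sup>2 - 2 * y * y + y\<^sup>2)"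
      by (intro tendsto_ennrealI tendsto_intros 1 2)
    then have "(\<lambda>N. ennreal (e2 N - 2 * y * e1 N + y\<^sup>2)) \<longlonglongrightarrow> 0" by (simp add: power2_eq_square)
    then show ?thesis by (intro lim_imp_Liminf) auto
  qed
  finally show "L = y" by (simp add: ennreal_eq_0_iff)
qed

lemma prod_powr_real:
  fixes x :: "'i \<Rightarrow> real"
  assumes "finite I" "\<And>i. i \<in> I \<Longrightarrow> x i \<ge> 0"
  shows "(\<Prod>i\<in>I. x i) powr p = (\<Prod>i\<in>I. x i powr p)"
  using assms by induction (auto simp: powr_mult prod_nonneg)

theorem mainTheorem4:
  fixes M :: "'w measure"
    and \<Sigma> :: "real^'n^'n"
    and G :: "nat \<Rightarrow> 'w \<Rightarrow> real^'n^'n"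
    and \<mu> :: "nat \<Rightarrow> real"
  assumes "prob_space M"
    and "pos_def \<Sigma>"
    and "prob_space.indep_vars M (\<lambda>_. borel) G {1..}"
    and "\<And>i. 1 \<le> i \<Longrightarrow> std_gaussian_matrix M (G i)"
    and "lyapunov_exponents M (\<lambda>i \<omega>. pos_def_sqrt \<Sigma> ** G i \<omega>) \<mu>"
  shows "(\<Sum>i = 1..CARD('n). \<mu> i) =
    1 / 2 * (ln (det \<Sigma>) + real CARD('n) * ln 2 +
      (\<Sum>j = 0..CARD('n) - 1. Digamma ((real j + 1) / 2)))"
proof -
  interpret prob_space M by fact
  define h where "h a = (\<Prod>m = 1..CARD('n). chi_moment a m)" for a
  define D where "D = (\<Sum>m = 1..CARD('n). ln 2 + Digamma (real m / 2))"
  define s where "s = det (pos_def_sqrt \<Sigma>)"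
  define E where "E = exp (\<Sum>i = 1..CARD('n). \<mu> i)"
  define Y where "Y N \<omega> = (\<Prod>i = 1..N. \<bar>det (G i \<omega>)\<bar> powr (- 1 / N))" for N \<omega>
  have s: "s = sqrt (det \<Sigma>)" "s > 0"
    using det_pos_def_sqrt[OF assms(2)] det_pos_def[OF assms(2)] by (auto simp: s_def)
  have E: "E > 0" by (simp add: E_def)
  have Gm: "G i \<in> borel_measurable M" if "i \<in> {1..}" for i
    using assms(3) that by (auto simp: indep_vars_def)
  have det_meas[measurable]: "(\<lambda>A :: real^'n^'n. det A) \<in> borel_measurable borel"
    by (intro borel_measurable_det) measurable
  have det_powr_meas: "(\<lambda>\<omega>. \<bar>det (G i \<omega>)\<bar> powr p) \<in> borel_measurable M" if "i \<in> {1..}" for i p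
    by (rule measurable_compose[OF Gm[OF that]]) measurable
  have moment: "has_bochner_integral M (\<lambda>\<omega>. \<Prod>i = 1..N. \<bar>det (G i \<omega>)\<bar> powr (- 2 * a)) (h a ^ N)"
    if a: "0 < a" "a < 1 / 2" for a N
  proof (rule has_bochner_integral_nn_integral)
    have h0: "h a \<ge> 0" unfolding h_def using a by (intro prod_nonneg) (auto intro: chi_moment_nonneg)
    have ind: "indep_vars (\<lambda>_. borel) (\<lambda>i \<omega>. ennreal (\<bar>det (G i \<omega>)\<bar> powr (- 2 * a))) {1..N}"
    proof (rule indep_vars_compose2[OF indep_vars_subset[OF assms(3)]])
      show "(\<lambda>A :: real^'n^'n. ennreal (\<bar>det A\<bar> powr (- 2 * a))) \<in> borel_measurable borel" by measurable
    qed auto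
    have "(\<integral>\<^sup>+\<omega>. ennreal (\<Prod>i = 1..N. \<bar>det (G i \<omega>)\<bar> powr (- 2 * a)) \<partial>M)
       = (\<integral>\<^sup>+\<omega>. (\<Prod>i = 1..N. ennreal (\<bar>det (G i \<omega>)\<bar> powr (- 2 * a))) \<partial>M)"
      by (subst prod_ennreal) auto
    also have "\<dots> = (\<Prod>i = 1..N. \<integral>\<^sup>+\<omega>. ennreal (\<bar>det (G i \<omega>)\<bar> powr (- 2 * a)) \<partial>M)"
      using ind by (intro indep_vars_nn_integral) auto
    also have "\<dots> = (\<Prod>i = 1..N. ennreal (h a))"
      unfolding h_def using assms(4) a by (intro prod.cong refl nn_integral_det_std_gaussian_matrix assms(1)) auto
    also have "\<dots> = ennreal (h a ^ N)"
      using h0 by (simp add: ennreal_power)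
    finally show "(\<integral>\<^sup>+\<omega>. ennreal (\<Prod>i = 1..N. \<bar>det (G i \<omega>)\<bar> powr (- 2 * a)) \<partial>M) = ennreal (h a ^ N)" .
    show "0 \<le> h a ^ N" using h0 by simp
    show "(\<lambda>\<omega>. \<Prod>i = 1..N. \<bar>det (G i \<omega>)\<bar> powr (- 2 * a)) \<in> borel_measurable M"
      by (intro borel_measurable_prod det_powr_meas) simp
  qed (auto intro!: prod_nonneg)
  \<comment> \<open>The reciprocal products converge to \<open>s / E\<close> almost surely; their moments determine this limit.\<close>
  have "s / E = exp (- (1 / 2) * D)"
  proof (rule AE_limit_eq_of_moments)
    show "Y N \<in> borel_measurable M" for N
      unfolding Y_def by (intro borel_measurable_prod det_powr_meas) simp
    have "AE \<omega> in M. \<exists>V. (\<lambda>N. let P = left_product (\<lambda>i. pos_def_sqrt \<Sigma> ** G i \<omega>) N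
              in psd_root (2 * N) (transpose P ** P)) \<longlonglongrightarrow> V \<and> eigenvalues_are V (\<lambda>i. exp (\<mu> i))"
      using assms(5) by (simp add: lyapunov_exponents_def)
    then show "AE \<omega> in M. (\<lambda>N. Y N \<omega>) \<longlonglongrightarrow> s / E"
    proof eventually_elim
      case (elim \<omega>)
      let ?P = "left_product (\<lambda>i. pos_def_sqrt \<Sigma> ** G i \<omega>)"
      from elim obtain V where V: "(\<lambda>N. psd_root (2 * N) (transpose (?P N) ** ?P N)) \<longlonglongrightarrow> V"
        "eigenvalues_are V (\<lambda>i. exp (\<mu> i))" by (auto simp: Let_def)
      have "det V = E"
        using det_eq_prod_eigenvalues[OF V(2)] by (simp add: E_def exp_sum)
      with tendsto_det[OF V(1)] have "(\<lambda>N. s / det (psd_root (2 * N) (transpose (?P N) ** ?P N))) \<longlonglongrightarrow> s / E"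
        using E by (intro tendsto_intros) auto
      moreover have "\<forall>\<^sub>F N in sequentially. s / det (psd_root (2 * N) (transpose (?P N) ** ?P N)) = Y N \<omega>"
        using eventually_gt_at_top[of 0]
      proof eventually_elim
        case (elim N)
        have "\<bar>det (?P N)\<bar> = s ^ N * (\<Prod>i = 1..N. \<bar>det (G i \<omega>)\<bar>)"
          using s by (simp add: det_left_product det_mul s_def[symmetric] prod.distrib abs_mult abs_prod)
        then have "det (psd_root (2 * N) (transpose (?P N) ** ?P N)) = (s ^ N) powr (1 / N) * (\<Prod>i = 1..N. \<bar>det (G i \<omega>)\<bar> powr (1 / N))"
          using elim s by (simp add: det_psd_root_gram powr_mult prod_nonneg prod_powr_real)
        also have "(s ^ N) powr (1 / N) = s"
          using s elim by (simp add: powr_realpow[symmetric] powr_powr)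
        \<comment> \<open>If the product vanishes, both sides are \<open>0\<close>: \<open>0 powr p = 0\<close> and \<open>s / 0 = 0\<close>.\<close>
        finally show ?case
          using s by (simp add: Y_def powr_minus_divide prod_dividef)
      qed
      ultimately show ?case by (rule Lim_transform_eventually)
    qed
    show "\<forall>\<^sub>F N in sequentially. has_bochner_integral M (Y N) (h ((1 / 2) / N) ^ N)"
      using eventually_ge_at_top[of 2]
    proof eventually_elim
      case (elim N)
      then show ?case using moment[of "(1 / 2) / N" N] by (simp add: Y_def[abs_def])
    qed
    show "(\<lambda>N. h ((1 / 2) / N) ^ N) \<longlonglongrightarrow> exp (- (1 / 2) * D)"
      unfolding h_def D_def by (rule chi_moment_prod_limit) simp
    show "\<forall>\<^sub>F N in sequentially. has_bochner_integral M (\<lambda>\<omega>. (Y N \<omega>)\<^sup>2) (h (1 / N) ^ N)"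
      \<comment> \<open>The moment formula needs \<open>1 / N < 1 / 2\<close>.\<close>
      using eventually_ge_at_top[of 3]
    proof eventually_elim
      case (elim N)
      have "(x powr (- 1 / N))\<^sup>2 = x powr (- 2 * (1 / N))" for x
        by (simp add: power2_eq_square powr_add[symmetric])
      then have "(Y N \<omega>)\<^sup>2 = (\<Prod>i = 1..N. \<bar>det (G i \<omega>)\<bar> powr (- 2 * (1 / N)))" for \<omega>
        by (simp only: Y_def prod_power_distrib)
      then show ?case using moment[of "1 / N" N] elim by simp
    qed
    have "(exp (- (1 / 2) * D))\<^sup>2 = exp (- 1 * D)"
      by (simp add: power2_eq_square exp_add[symmetric])
    then show "(\<lambda>N. h (1 / N) ^ N) \<longlonglongrightarrow> (exp (- (1 / 2) * D))\<^sup>2"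
      unfolding h_def D_def using chi_moment_prod_limit[of 1 "CARD('n)"] by simp
  qed
  then have "E = s * exp (1 / 2 * D)"
    using E by (simp add: exp_minus field_simps)
  then have "ln E = ln s + 1 / 2 * D" using s by (simp add: ln_mult)
  moreover have "ln s = 1 / 2 * ln (det \<Sigma>)"
    using det_pos_def[OF assms(2)] by (simp add: s ln_sqrt)
  moreover have "D = real CARD('n) * ln 2 + (\<Sum>j = 0..CARD('n) - 1. Digamma ((real j + 1) / 2))"
  proof -
    have "(\<Sum>m = 1..CARD('n). Digamma (real m / 2)) = (\<Sum>m = Suc 0..Suc (CARD('n) - 1). Digamma (real m / 2))"
      by simp
    also have "\<dots> = (\<Sum>j = 0..CARD('n) - 1. Digamma ((real j + 1) / 2))"
      by (subst sum.shift_bounds_cl_Suc_ivl) (simp add: add.commute)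
    finally show ?thesis by (simp add: D_def sum.distrib)
  qed
  ultimately show ?thesis by (simp add: E_def algebra_simps)
qed

end
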